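(* For any graph $H$ and any positive integer $k$, \[ \delta^{\ast}_{\chi}(H,k)=\delta_{\chi}(H\text{-hom},k). \]
   Context: All graphs are finite and simple; $\delta(G)$ is minimum degree and $|G|$ the number of vertices; $G$ is $H$-free if it contains no subgraph isomorphic to $H$; $H\to G$ means $H$ is homomorphic to $G$ (there is a map $V(H)\to V(G)$ sending edges to edges). The approximate chromatic profile $\delta^{\ast}_{\chi}(H,k)$ is the infimum of all $c$ such that for every $\eta>0$ there is $n_0$ such that every $H$-free graph $G$ on $n\ge n_0$ vertices with $\delta(G)\ge cn$ can be made $k$-colourable by deleting at most $\eta n^2$ edges. The quantity $\delta_{\chi}(H\text{-hom},k)$ is the infimum of all $c$ such that every graph $G$ with $\delta(G)\ge c|G|$ and $H$ not homomorphic to $G$ is $k$-colourable. *)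

theory Defs
  imports Complex_Main
begin

record 'a ugraph =
  verts :: "'a set"
  edges :: "'a set set"

definition simple_graph :: "'a ugraph \<Rightarrow> bool" where
  "simple_graph G \<longleftrightarrow>
     finite (verts G) \<and> (\<forall>e\<in>edges G. e \<subseteq> verts G \<and> card e = 2)"

definition graph_order :: "'a ugraph \<Rightarrow> nat" where
  "graph_order G = card (verts G)"

definition vertex_degree :: "'a ugraph \<Rightarrow> 'a \<Rightarrow> nat" where
  "vertex_degree G v = card {u \<in> verts G. {u, v} \<in> edges G}"

(* The value for the graph without vertices is unspecified. It does not matter below, where
   min_degree is only compared with a multiple of the order and any nat is \<ge> 0. *)
definition min_degree :: "'a ugraph \<Rightarrow> nat" where
  "min_degree G = Min (vertex_degree G ` verts G)"

definition subgraph :: "'a ugraph \<Rightarrow> 'a ugraph \<Rightarrow> bool" where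
  "subgraph K G \<longleftrightarrow> simple_graph K \<and> verts K \<subseteq> verts G \<and> edges K \<subseteq> edges G"

definition isomorphic :: "'a ugraph \<Rightarrow> 'b ugraph \<Rightarrow> bool" where
  "isomorphic G H \<longleftrightarrow>
     (\<exists>f. bij_betw f (verts G) (verts H) \<and>
          (\<forall>u\<in>verts G. \<forall>v\<in>verts G. {u, v} \<in> edges G \<longleftrightarrow> {f u, f v} \<in> edges H))"

definition graph_free :: "'a ugraph \<Rightarrow> 'b ugraph \<Rightarrow> bool" where
  "graph_free H G \<longleftrightarrow> \<not> (\<exists>K. subgraph K G \<and> isomorphic H K)"

definition homomorphic :: "'a ugraph \<Rightarrow> 'b ugraph \<Rightarrow> bool" where
  "homomorphic H G \<longleftrightarrow>
     (\<exists>f. f ` verts H \<subseteq> verts G \<and>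
          (\<forall>u v. {u, v} \<in> edges H \<longrightarrow> {f u, f v} \<in> edges G))"

definition colourable :: "nat \<Rightarrow> 'a ugraph \<Rightarrow> bool" where
  "colourable k G \<longleftrightarrow>
     (\<exists>c. c ` verts G \<subseteq> {..<k} \<and> (\<forall>u v. {u, v} \<in> edges G \<longrightarrow> c u \<noteq> c v))"

definition delete_edges :: "'a ugraph \<Rightarrow> 'a set set \<Rightarrow> 'a ugraph" where
  "delete_edges G F = \<lparr>verts = verts G, edges = edges G - F\<rparr>"

lemma isomorphic_nat_graph:
  assumes "simple_graph G"
  shows "\<exists>G' :: nat ugraph. simple_graph G' \<and> isomorphic G G'"
proof -
  from assms have fin: "finite (verts G)" by (simp add: simple_graph_def)
  then obtain f :: "'a \<Rightarrow> nat" where f: "inj_on f (verts G)"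
    using finite_imp_inj_to_nat_seg by metis
  have sub: "e \<subseteq> verts G" and two: "card e = 2" if "e \<in> edges G" for e
    using assms that by (auto simp: simple_graph_def)
  define G' where "G' = \<lparr>verts = f ` verts G, edges = (\<lambda>e. f ` e) ` edges G\<rparr>"
  have "card (f ` e) = 2" if "e \<in> edges G" for e
    using card_image[OF inj_on_subset[OF f sub[OF that]]] two[OF that] by simp
  then have "simple_graph G'"
    using fin sub by (auto simp: simple_graph_def G'_def)
  moreover have "{u, v} \<in> edges G \<longleftrightarrow> {f u, f v} \<in> edges G'"
    if "u \<in> verts G" "v \<in> verts G" for u v
  proof
    assume "{f u, f v} \<in> edges G'"
    then obtain e where e: "e \<in> edges G" "f ` {u, v} = f ` e" by (auto simp: G'_def)
    then have "{u, v} = e"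
      using inj_on_image_eq_iff[OF f _ sub[OF e(1)], of "{u, v}"] that by simp
    with e show "{u, v} \<in> edges G" by simp
  qed (auto simp: G'_def intro: image_eqI[of _ _ "{u, v}"])
  moreover have "bij_betw f (verts G) (verts G')"
    using f by (simp add: bij_betw_def G'_def)
  ultimately show ?thesis
    unfolding isomorphic_def by blast
qed

(* In both infima G ranges over graphs with vertices in nat, which by isomorphic_nat_graph is
   every finite simple graph up to isomorphism. The bound c \<ge> 0 is the usual convention that
   densities are nonnegative: without it the set is all of the reals whenever 0 qualifies, and
   Inf is then an unspecified real. *)

definition approx_chromatic_profile :: "'a ugraph \<Rightarrow> nat \<Rightarrow> real" where
  "approx_chromatic_profile H k =
     Inf {c::real. c \<ge> 0 \<and>
       (\<forall>\<eta>>0. \<exists>n0::nat. \<forall>G :: nat ugraph.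
          simple_graph G \<and> graph_order G \<ge> n0 \<and> graph_free H G \<and>
          real (min_degree G) \<ge> c * real (graph_order G) \<longrightarrow>
          (\<exists>F\<subseteq>edges G. real (card F) \<le> \<eta> * (real (graph_order G))\<^sup>2 \<and>
                         colourable k (delete_edges G F)))}"

definition hom_chromatic_profile :: "'a ugraph \<Rightarrow> nat \<Rightarrow> real" where
  "hom_chromatic_profile H k =
     Inf {c::real. c \<ge> 0 \<and>
       (\<forall>G :: nat ugraph.
          simple_graph G \<and> real (min_degree G) \<ge> c * real (graph_order G) \<and>
          \<not> homomorphic H G \<longrightarrow> colourable k G)}"

end

theory Submission
  imports Defs "HOL-Library.FuncSet"
begin

text \<open>
  If \<open>H\<close> is not homomorphic to \<open>G\<close> then every blow-up of \<open>G\<close> is \<open>H\<close>-free, and if \<open>G\<close> is moreover not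
  \<open>k\<close>-colourable then giving each vertex the most popular colour of its fibre shows that a positive
  proportion of the pairs of vertices of the blow-up has to be deleted to make it \<open>k\<close>-colourable.

  The converse replaces the regularity lemma by sampling. Let \<open>G\<close> be a large \<open>H\<close>-free graph of minimum
  degree at least \<open>c n\<close>, far from \<open>k\<close>-colourable, and let \<open>b < c\<close>. A random tuple of vertices of a
  suitable constant length \<open>N\<close> spans a graph that is not \<open>k\<close>-colourable with probability bounded away
  from zero (the Goldreich--Goldwasser--Ron argument), and it has minimum degree at least \<open>b N\<close> with
  probability close to one. If \<open>b\<close> is admissible for the homomorphism threshold, then \<open>H\<close> is homomorphic
  to a positive proportion of the sampled graphs, hence by the pigeonhole principle one fixed homomorphic
  image of \<open>H\<close> has positive density in \<open>G\<close>. By the theorem of Erdos on dense relations \<open>G\<close> then contains a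
  blow-up of that image, and so \<open>H\<close> itself.
\<close>

subsection \<open>Boxes in dense relations\<close>

text \<open>Fibre counting over the entry at \<open>j\<close>. This one-coordinate form of Fubini
  drives both the induction on \<open>J\<close> for boxes and the addition of a sampled vertex in
  the colouring test.\<close>

lemma card_tuples_insert:
  assumes "finite J" "finite V" "j \<notin> J" "R \<subseteq> insert j J \<rightarrow>\<^sub>E V"
  shows "card R = (\<Sum>v\<in>V. card {x \<in> J \<rightarrow>\<^sub>E V. x(j := v) \<in> R})"
proof -
  let ?h = "\<lambda>(v, x). x(j := v)"
  let ?P = "SIGMA v:V. {x \<in> J \<rightarrow>\<^sub>E V. x(j := v) \<in> R}"
  have "inj_on ?h ?P"
    by (rule inj_on_subset[OF inj_combinator[of j J "\<lambda>_. V"]]) (use assms in auto)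
  moreover have "?h ` ?P = R"
  proof
    show "R \<subseteq> ?h ` ?P"
    proof
      fix r assume r: "r \<in> R"
      then obtain v x where "v \<in> V" "x \<in> J \<rightarrow>\<^sub>E V" "r = x(j := v)"
        using assms(4) unfolding PiE_insert_eq by auto
      with r show "r \<in> ?h ` ?P" by force
    qed
  qed auto
  ultimately have "card R = card ?P" using card_image[of ?h ?P] by simp
  also have "\<dots> = (\<Sum>v\<in>V. card {x \<in> J \<rightarrow>\<^sub>E V. x(j := v) \<in> R})"
    using assms finite_PiE[of J "\<lambda>_. V"] by (intro card_SigmaI) auto
  finally show ?thesis .
qed

text \<open>Reverse Markov inequality: the elements with value below half of the average bound
  contribute at most half of the sum, and each other element contributes at most
  \<open>c\<close>.\<close>

lemma card_large_values:
  fixes g :: "'a \<Rightarrow> real"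
  assumes "finite A" and g: "\<And>a. a \<in> A \<Longrightarrow> g a \<le> c" and "c > 0"
    and sum: "(\<Sum>a\<in>A. g a) \<ge> \<beta> * c * real (card A)" and "\<beta> \<ge> 0"
  shows "real (card {a \<in> A. g a \<ge> \<beta> / 2 * c}) \<ge> \<beta> / 2 * real (card A)"
proof -
  let ?L = "{a \<in> A. g a \<ge> \<beta> / 2 * c}"
  have "\<beta> * c * real (card A) \<le> (\<Sum>a\<in>A. g a)" by (fact sum)
  also have "\<dots> \<le> (\<Sum>a\<in>A. (if a \<in> ?L then c else 0) + \<beta> / 2 * c)"
    using g assms(3,5) by (intro sum_mono) (auto simp: add_increasing2)
  also have "\<dots> = c * card ?L + \<beta> / 2 * c * card A"
    using assms(1) by (simp add: sum.distrib sum.If_cases Int_def conj_commute)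
  finally have "c * (\<beta> / 2 * real (card A)) \<le> c * card ?L"
    by (simp add: algebra_simps)
  then show ?thesis using \<open>c > 0\<close> by simp
qed

text \<open>Only a constant number \<open>s\<close> of vertices of large degree is kept. A positive
  proportion of \<open>X\<close> is then related to at least \<open>t\<close> of them, and there are
  at most \<open>2 ^ s\<close> candidates for the set \<open>T\<close>, so one candidate serves many
  \<open>x\<close>. The loss depends on \<open>s\<close> but not on the size of
  \<open>V\<close>.\<close>

lemma dense_bipartite_common_neighbours:
  fixes \<beta> :: real and s t :: nat and Q :: "'v \<Rightarrow> 'x \<Rightarrow> bool"
  assumes "finite V" "finite X" "X \<noteq> {}" "\<beta> > 0"
    and dens: "(\<Sum>v\<in>V. real (card {x \<in> X. Q v x})) \<ge> \<beta> * real (card X) * real (card V)"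
    and s: "s > 0" "\<beta> / 4 * real s \<ge> real t" "real s \<le> \<beta> / 2 * real (card V)"
  shows "\<exists>T\<subseteq>V. card T = t \<and> real (card {x \<in> X. \<forall>v\<in>T. Q v x}) \<ge> \<beta> / 4 / 2 ^ s * real (card X)"
proof -
  define e where "e v = real (card {x \<in> X. Q v x})" for v
  have Xpos: "real (card X) > 0" using assms(2,3) by (simp add: card_gt_0_iff)
  have "e v \<le> real (card X)" for v
    unfolding e_def using assms(2) by (intro of_nat_mono card_mono) auto
  then have "\<beta> / 2 * real (card V) \<le> real (card {v \<in> V. e v \<ge> \<beta> / 2 * real (card X)})"
    using dens \<open>\<beta> > 0\<close> by (intro card_large_values[OF assms(1) _ Xpos]) (auto simp: e_def)
  then have "s \<le> card {v \<in> V. e v \<ge> \<beta> / 2 * real (card X)}" using s(3) by linarith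
  then obtain W where W: "W \<subseteq> {v \<in> V. e v \<ge> \<beta> / 2 * real (card X)}" "card W = s" "finite W"
    by (rule obtain_subset_with_card_n)
  define N where "N x = {v \<in> W. Q v x}" for x
  have N: "N x \<subseteq> W" for x by (auto simp: N_def)
  have cN: "card (N x) \<le> s" for x using card_mono[OF W(3) N] W(2) by simp
  define Y where "Y = {x \<in> X. card (N x) \<ge> t}"
  have Y: "finite Y" "Y \<subseteq> X" using assms(2) by (auto simp: Y_def)
  have "\<beta> / 2 * real s * real (card X) = (\<Sum>v\<in>W. \<beta> / 2 * real (card X))"
    using W by simp
  also have "\<dots> \<le> (\<Sum>v\<in>W. e v)"
    using W by (intro sum_mono) auto
  also have "\<dots> = (\<Sum>v\<in>W. \<Sum>x\<in>X. if Q v x then 1 else 0)"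
    using assms(2) by (simp add: e_def sum.If_cases Int_def)
  also have "\<dots> = (\<Sum>x\<in>X. \<Sum>v\<in>W. if Q v x then 1 else 0)"
    by (rule sum.swap)
  also have "\<dots> = (\<Sum>x\<in>X. real (card (N x)))"
    using W by (simp add: N_def sum.If_cases Int_def)
  finally have sm: "\<beta> / 2 * real s * real (card X) \<le> (\<Sum>x\<in>X. real (card (N x)))" .
  have "\<beta> / 2 / 2 * real (card X) \<le> real (card {x \<in> X. real (card (N x)) \<ge> \<beta> / 2 / 2 * real s})"
    using cN s(1) \<open>\<beta> > 0\<close> by (intro card_large_values[OF assms(2) _ _ sm]) auto
  also have "\<dots> \<le> real (card Y)"
    using s(2) assms(2) by (intro of_nat_mono card_mono) (auto simp: Y_def)
  finally have cY: "\<beta> / 4 * real (card X) \<le> real (card Y)" by simp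
  have "\<exists>T. T \<subseteq> N x \<and> card T = t" if "x \<in> Y" for x
    using that obtain_subset_with_card_n[of t "N x"] by (auto simp: Y_def)
  then obtain T where T: "\<And>x. x \<in> Y \<Longrightarrow> T x \<subseteq> N x \<and> card (T x) = t" by metis
  \<comment> \<open>Pigeonhole over the subsets of \<open>W\<close>: some \<open>S\<close> is the
    chosen \<open>t\<close>-set for at least a fraction \<open>1 / 2 ^ s\<close> of
    \<open>Y\<close>.\<close>
  have "T \<in> Y \<rightarrow> Pow W" using T N by blast
  from pigeonhole_card[OF this Y(1)]
  obtain S where S: "S \<subseteq> W" "card Y \<le> card (T -` {S} \<inter> Y) * 2 ^ s"
    using W(2,3) by (auto simp: card_Pow)
  have "\<beta> / 4 * real (card X) \<le> real (card (T -` {S} \<inter> Y) * 2 ^ s)"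
    using cY S(2) by linarith
  then have dS: "\<beta> / 4 / 2 ^ s * real (card X) \<le> real (card (T -` {S} \<inter> Y))"
    by (simp add: field_simps)
  then have "real (card (T -` {S} \<inter> Y)) > 0"
    using Xpos \<open>\<beta> > 0\<close> by (smt (verit) divide_pos_pos mult_pos_pos zero_less_power)
  then obtain x where "x \<in> Y" "T x = S" by (auto simp: card_gt_0_iff)
  then have "card S = t" using T by auto
  moreover have "T -` {S} \<inter> Y \<subseteq> {x \<in> X. \<forall>v\<in>S. Q v x}"
    using T Y(2) by (auto simp: N_def)
  then have "card (T -` {S} \<inter> Y) \<le> card {x \<in> X. \<forall>v\<in>S. Q v x}"
    using assms(2) by (intro card_mono) auto
  then have "\<beta> / 4 / 2 ^ s * real (card X) \<le> real (card {x \<in> X. \<forall>v\<in>S. Q v x})"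
    using dS by linarith
  moreover have "S \<subseteq> V" using S(1) W(1) by auto
  ultimately show ?thesis by blast
qed

text \<open>Induction on the set of coordinates. For the new coordinate \<open>j\<close> a
  \<open>t\<close>-set \<open>T\<close> is found such that the tuples on \<open>J\<close> that
  extend into \<open>R\<close> by every element of \<open>T\<close> are still dense; a box among
  these tuples, multiplied by \<open>T\<close>, is a box in \<open>R\<close>.\<close>

lemma dense_relation_contains_box:
  fixes \<beta> :: real and t :: nat
  assumes "finite J" "\<beta> > 0"
  shows "\<exists>n0. \<forall>V :: 'v set. \<forall>R. finite V \<and> card V \<ge> n0 \<and> R \<subseteq> J \<rightarrow>\<^sub>E V \<and>
           real (card R) \<ge> \<beta> * real (card V) ^ card J \<longrightarrow>
           (\<exists>A. (\<forall>j\<in>J. A j \<subseteq> V \<and> card (A j) = t) \<and> PiE J A \<subseteq> R)"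
  using assms
proof (induction J arbitrary: \<beta> rule: finite_induct)
  case empty
  show ?case
  proof (intro exI[of _ 0] allI impI)
    fix V :: "'v set" and R :: "('a \<Rightarrow> 'v) set"
    assume *: "finite V \<and> 0 \<le> card V \<and> R \<subseteq> {} \<rightarrow>\<^sub>E V \<and> \<beta> * real (card V) ^ card ({}::'a set) \<le> real (card R)"
    then have "R \<noteq> {}" using empty by auto
    then show "\<exists>A. (\<forall>j\<in>{}. A j \<subseteq> V \<and> card (A j) = t) \<and> PiE {} A \<subseteq> R"
      using * by auto
  qed
next
  case (insert j J)
  \<comment> \<open>Large enough that a quarter of \<beta> times \<open>s\<close> is at least
    \<open>t\<close>; \<open>Suc\<close> keeps \<open>s\<close> positive when \<open>t\<close> is
    0.\<close>
  define s :: nat where "s = Suc (nat \<lceil>4 * real t / \<beta>\<rceil>)"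
  have s: "\<beta> / 4 * real s \<ge> real t"
  proof -
    have "real s \<ge> 4 * real t / \<beta>"
      unfolding s_def using real_nat_ceiling_ge[of "4 * real t / \<beta>"] by linarith
    then show ?thesis using insert.prems by (simp add: field_simps)
  qed
  define \<gamma> where "\<gamma> = \<beta> / 4 / 2 ^ s"
  have "\<gamma> > 0" using insert.prems by (simp add: \<gamma>_def)
  from insert.IH[OF this] obtain n1 where n1: "\<forall>V :: 'v set. \<forall>R. finite V \<and> card V \<ge> n1 \<and> R \<subseteq> J \<rightarrow>\<^sub>E V \<and>
           real (card R) \<ge> \<gamma> * real (card V) ^ card J \<longrightarrow>
           (\<exists>A. (\<forall>j\<in>J. A j \<subseteq> V \<and> card (A j) = t) \<and> PiE J A \<subseteq> R)" ..
  \<comment> \<open>Besides the bound for \<open>J\<close>, the set \<open>V\<close> has to be large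
    enough to supply \<open>s\<close> vertices of large degree; \<open>Suc\<close> makes it
    nonempty.\<close>
  define n0 where "n0 = max n1 (Suc (nat \<lceil>2 * real s / \<beta>\<rceil>))"
  show ?case
  proof (intro exI[of _ n0] allI impI, elim conjE)
    fix V :: "'v set" and R :: "('a \<Rightarrow> 'v) set"
    assume V: "finite V" "n0 \<le> card V" and R: "R \<subseteq> insert j J \<rightarrow>\<^sub>E V"
      and Rc: "\<beta> * real (card V) ^ card (insert j J) \<le> real (card R)"
    define X where "X = J \<rightarrow>\<^sub>E V"
    have "V \<noteq> {}" using V(2) by (auto simp: n0_def)
    then have X: "finite X" "card X = card V ^ card J" "X \<noteq> {}"
      using V insert.hyps by (auto simp: X_def card_funcsetE PiE_eq_empty_iff intro: finite_PiE)
    have "(\<Sum>v\<in>V. real (card {x \<in> X. x(j := v) \<in> R})) = real (card R)"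
      using card_tuples_insert[OF insert.hyps(1) V(1) insert.hyps(2) R]
      by (simp add: X_def)
    then have dens: "(\<Sum>v\<in>V. real (card {x \<in> X. x(j := v) \<in> R})) \<ge> \<beta> * real (card X) * real (card V)"
      using Rc insert.hyps by (simp add: X mult.assoc mult.commute[of "real (card V)"])
    have "2 * real s / \<beta> \<le> real (card V)"
      using V(2) real_nat_ceiling_ge[of "2 * real s / \<beta>"] unfolding n0_def by linarith
    then have "real s \<le> \<beta> / 2 * real (card V)" using insert.prems by (simp add: field_simps)
    from dense_bipartite_common_neighbours[OF V(1) X(1,3) insert.prems dens _ s this]
    obtain T where T: "T \<subseteq> V" "card T = t"
      and cT: "real (card {x \<in> X. \<forall>v\<in>T. x(j := v) \<in> R}) \<ge> \<gamma> * real (card V) ^ card J"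
      by (auto simp: s_def \<gamma>_def X)
    define R' where "R' = {x \<in> X. \<forall>v\<in>T. x(j := v) \<in> R}"
    have "R' \<subseteq> J \<rightarrow>\<^sub>E V" by (auto simp: R'_def X_def)
    then obtain A where A: "\<forall>i\<in>J. A i \<subseteq> V \<and> card (A i) = t" "PiE J A \<subseteq> R'"
      using n1[rule_format, of V R'] V cT by (auto simp: n0_def R'_def)
    show "\<exists>A. (\<forall>i\<in>insert j J. A i \<subseteq> V \<and> card (A i) = t) \<and> PiE (insert j J) A \<subseteq> R"
    proof (intro exI[of _ "A(j := T)"] conjI ballI)
      fix i assume "i \<in> insert j J"
      then show "(A(j := T)) i \<subseteq> V" "card ((A(j := T)) i) = t"
        using A(1) T by auto
    next
      have eq: "PiE J (A(j := T)) = PiE J A" using insert.hyps by (intro PiE_cong) auto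
      show "PiE (insert j J) (A(j := T)) \<subseteq> R"
        using A(2) unfolding PiE_insert_eq eq by (auto simp: R'_def)
    qed
  qed
qed

text \<open>Greedy choice: the elements chosen before are fewer than the elements of the next set.
  The sets may overlap or coincide, as they do when several vertices of \<open>H\<close> are mapped
  to the same position.\<close>

lemma distinct_representatives_of_large_sets:
  assumes "finite I" and "\<And>i. i \<in> I \<Longrightarrow> card (A i) \<ge> card I"
  shows "\<exists>y. inj_on y I \<and> (\<forall>i\<in>I. y i \<in> A i)"
  using assms
proof (induction I rule: finite_induct)
  case (insert i I)
  then obtain y where y: "inj_on y I" "\<And>i. i \<in> I \<Longrightarrow> y i \<in> A i" by force
  have "card (y ` I) < card (A i)"
    using insert.prems[of i] insert.hyps card_image_le[OF insert.hyps(1), of y] by simp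
  then obtain a where a: "a \<in> A i" "a \<notin> y ` I"
    by (metis card_mono finite_imageI insert.hyps(1) leD subsetI)
  have "inj_on (y(i := a)) (insert i I)"
    using y a insert.hyps by (auto simp: inj_on_def)
  moreover have "\<forall>i'\<in>insert i I. (y(i := a)) i' \<in> A i'" using y a by auto
  ultimately show ?case by blast
qed auto

subsection \<open>Degrees in random tuples\<close>

text \<open>This is the base for a Chernoff bound: a random entry multiplies the moment by at most
  \<open>1 - (1 - r) * c\<close>, and this has to beat the threshold \<open>r powr b\<close>. With
  \<open>r = exp (- l)\<close> the comparison is \<open>l * b < l / (1 + l) * c\<close>, which holds
  for small \<open>l\<close> because \<open>b < c\<close>.\<close>

lemma exponential_moment_base:
  fixes b c :: real
  assumes "0 \<le> b" "b < c" "c \<le> 1"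
  shows "\<exists>r. 0 < r \<and> r < 1 \<and> 1 - (1 - r) * c < r powr b"
proof -
  define l where "l = (c - b) / 2"
  have l: "l > 0" "b * (1 + l) < c"
  proof -
    show "l > 0" using assms by (simp add: l_def)
    then have "b * l \<le> l" using assms by (simp add: mult_left_le_one_le)
    moreover have "l < c - b" using assms by (simp add: l_def)
    ultimately show "b * (1 + l) < c" by (simp add: distrib_left)
  qed
  have "exp (- l) \<le> 1 / (1 + l)"
    using exp_ge_add_one_self[of l] l by (simp add: exp_minus field_simps)
  then have "l / (1 + l) \<le> 1 - exp (- l)" using l by (simp add: field_simps)
  then have "l / (1 + l) * c \<le> (1 - exp (- l)) * c"
    using assms by (intro mult_right_mono) auto
  moreover have "b < c / (1 + l)" using l by (simp add: pos_less_divide_eq)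
  then have "l * b < l / (1 + l) * c" using mult_strict_left_mono[of b "c / (1 + l)" l] l by simp
  moreover have "1 - l * b \<le> exp (- l) powr b"
    using exp_ge_add_one_self[of "- l * b"] by (simp add: powr_def mult.commute)
  ultimately have "1 - (1 - exp (- l)) * c < exp (- l) powr b" by linarith
  then show ?thesis using l by (intro exI[of _ "exp (- l)"]) auto
qed

lemma card_tuples_low_degree_position:
  fixes b c r :: real and nb :: "'v \<Rightarrow> 'v \<Rightarrow> bool"
  assumes "finite V" "finite I" "i \<in> I" "0 < r" "r < 1" "c \<le> 1"
    and deg: "\<And>v. v \<in> V \<Longrightarrow> c * real (card V) \<le> real (card {u \<in> V. nb v u})"
  shows "real (card {x \<in> I \<rightarrow>\<^sub>E V. real (card {j \<in> I. nb (x i) (x j)}) < b * real (card I)}) *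
           r powr (b * real (card I))
         \<le> real (card V) ^ card I * (1 - (1 - r) * c) ^ (card I - 1)"
proof -
  let ?n = "real (card V)" and ?a = "1 - (1 - r) * c"
  define B where "B = {x \<in> I \<rightarrow>\<^sub>E V. real (card {j \<in> I. nb (x i) (x j)}) < b * real (card I)}"
  \<comment> \<open>Chernoff bound: each low-degree tuple contributes at least \<open>r powr (b N)\<close> to the sum of \<open>r\<close> to the
    number of neighbours of \<open>x i\<close>; the factor \<open>g v i\<close> conditions on \<open>x i = v\<close>, so that this sum factorises.\<close>
  define h where "h v u = (if nb v u then r else 1)" for v u
  define g where "g v j u = (if j = i then (if u = v then 1 else 0) else h v u)" for v j u
  have fin: "finite (I \<rightarrow>\<^sub>E V)" using assms by (auto intro: finite_PiE)
  have h0: "h v u \<ge> 0" for v u using assms by (simp add: h_def)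
  have "real (card B) * r powr (b * real (card I)) = (\<Sum>x\<in>B. r powr (b * real (card I)))" by simp
  also have "\<dots> \<le> (\<Sum>x\<in>B. \<Prod>j\<in>I-{i}. h (x i) (x j))"
  proof (rule sum_mono)
    fix x assume "x \<in> B"
    have "(\<Prod>j\<in>I-{i}. h (x i) (x j)) = r ^ card {j \<in> I - {i}. nb (x i) (x j)}"
      using assms(2) by (simp add: h_def prod.If_cases Int_def)
    also have "\<dots> = r powr real (card {j \<in> I - {i}. nb (x i) (x j)})"
      using assms by (simp add: powr_realpow)
    also have "\<dots> \<ge> r powr (b * real (card I))"
    proof (rule powr_mono')
      have "card {j \<in> I - {i}. nb (x i) (x j)} \<le> card {j \<in> I. nb (x i) (x j)}"
        using assms(2) by (intro card_mono) auto
      then show "real (card {j \<in> I - {i}. nb (x i) (x j)}) \<le> b * real (card I)"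
        using \<open>x \<in> B\<close> by (simp add: B_def)
    qed (use assms in auto)
    finally show "r powr (b * real (card I)) \<le> (\<Prod>j\<in>I-{i}. h (x i) (x j))" .
  qed
  also have "\<dots> \<le> (\<Sum>x\<in>I \<rightarrow>\<^sub>E V. \<Prod>j\<in>I-{i}. h (x i) (x j))"
    using fin h0 by (intro sum_mono2) (auto simp: B_def intro: prod_nonneg)
  also have "\<dots> = (\<Sum>x\<in>I \<rightarrow>\<^sub>E V. \<Sum>v\<in>V. \<Prod>j\<in>I. g v j (x j))"
  proof (rule sum.cong[OF refl])
    fix x assume x: "x \<in> I \<rightarrow>\<^sub>E V"
    have "(\<Sum>v\<in>V. \<Prod>j\<in>I. g v j (x j)) = (\<Sum>v\<in>V. if v = x i then \<Prod>j\<in>I-{i}. h v (x j) else 0)"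
      using assms by (intro sum.cong refl) (auto simp: prod.remove[of I i] g_def)
    also have "\<dots> = (\<Prod>j\<in>I-{i}. h (x i) (x j))"
      using assms x by (auto simp: PiE_def Pi_def)
    finally show "(\<Prod>j\<in>I-{i}. h (x i) (x j)) = (\<Sum>v\<in>V. \<Prod>j\<in>I. g v j (x j))" ..
  qed
  also have "\<dots> = (\<Sum>v\<in>V. \<Sum>x\<in>I \<rightarrow>\<^sub>E V. \<Prod>j\<in>I. g v j (x j))" by (rule sum.swap)
  also have "\<dots> = (\<Sum>v\<in>V. \<Prod>j\<in>I. \<Sum>u\<in>V. g v j u)"
    using assms by (simp add: prod_sum_PiE)
  \<comment> \<open>The factor at \<open>i\<close> is 1, since only \<open>u = v\<close> survives
    there, so \<open>card I - 1\<close> factors remain. The sum over \<open>v\<close> restores the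
    missing power of \<open>?n\<close>.\<close>
  also have "\<dots> \<le> (\<Sum>v\<in>V. (?n * ?a) ^ (card I - 1))"
  proof (rule sum_mono)
    fix v assume v: "v \<in> V"
    have "(\<Sum>u\<in>V. h v u) = r * card {u \<in> V. nb v u} + (?n - card {u \<in> V. nb v u})"
    proof -
      have "(\<Sum>u\<in>V. h v u) = (\<Sum>u\<in>V. 1 - (if nb v u then 1 - r else 0))"
        by (intro sum.cong) (auto simp: h_def)
      also have "\<dots> = ?n - (1 - r) * card {u \<in> V. nb v u}"
        using assms(1) by (simp add: sum_subtractf sum.If_cases Int_def)
      finally show ?thesis by (simp add: algebra_simps)
    qed
    also have "\<dots> \<le> ?n * ?a"
      using mult_left_mono[OF deg[OF v], of "1 - r"] assms by (simp add: algebra_simps)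
    finally have hs: "(\<Sum>u\<in>V. h v u) \<le> ?n * ?a" .
    have "(\<Prod>j\<in>I. \<Sum>u\<in>V. g v j u) = (\<Prod>j\<in>I-{i}. \<Sum>u\<in>V. h v u)"
      using assms v by (simp add: prod.remove[of I i] g_def)
    also have "\<dots> = (\<Sum>u\<in>V. h v u) ^ (card I - 1)"
      using assms by (simp add: card_Diff_singleton)
    also have "\<dots> \<le> (?n * ?a) ^ (card I - 1)"
      using hs h0 by (intro power_mono sum_nonneg) auto
    finally show "(\<Prod>j\<in>I. \<Sum>u\<in>V. g v j u) \<le> (?n * ?a) ^ (card I - 1)" .
  qed
  also have "\<dots> = ?n ^ Suc (card I - 1) * ?a ^ (card I - 1)"
    by (simp add: power_mult_distrib)
  also have "Suc (card I - 1) = card I" using assms by (metis Suc_pred' card_gt_0_iff empty_iff)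
  finally show ?thesis by (simp add: B_def)
qed

text \<open>Union bound over the \<open>N\<close> positions: each one fails with probability at most
  \<open>q ^ N / a\<close> for a fixed \<open>q < 1\<close>, and \<open>N * q ^ N\<close> tends to
  0. The bound \<open>N0\<close> is uniform in \<open>V\<close> and \<open>nb\<close>.\<close>

lemma most_tuples_inherit_min_degree:
  fixes b c \<delta> :: real
  assumes "0 \<le> b" "b < c" "c \<le> 1" "\<delta> > 0"
  shows "\<exists>N0. \<forall>N\<ge>N0. \<forall>V :: 'v set. \<forall>nb. finite V \<and>
           (\<forall>v\<in>V. c * real (card V) \<le> real (card {u \<in> V. nb v u})) \<longrightarrow>
           real (card {x \<in> {..<N} \<rightarrow>\<^sub>E V. \<exists>i<N. real (card {j \<in> {..<N}. nb (x i) (x j)}) < b * real N})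
             \<le> \<delta> * real (card V) ^ N"
proof -
  obtain r where r: "0 < r" "r < 1" "1 - (1 - r) * c < r powr b"
    using exponential_moment_base[OF assms(1-3)] by blast
  define a where "a = 1 - (1 - r) * c"
  define q where "q = a / r powr b"
  have "(1 - r) * c < 1"
  proof -
    have "(1 - r) * c \<le> 1 - r" using r assms by (simp add: mult_left_le)
    then show ?thesis using r by linarith
  qed
  then have a: "a > 0" by (simp add: a_def)
  have q: "0 < q" "q < 1" using a r by (auto simp: q_def a_def)
  have "(\<lambda>N. real N * q ^ N) \<longlonglongrightarrow> 0"
    using powser_times_n_limit_0[of q] q by simp
  then have "eventually (\<lambda>N. real N * q ^ N < \<delta> * a) sequentially"
    using a assms by (intro order_tendstoD) auto
  then obtain N0 where N0: "\<And>N. N \<ge> N0 \<Longrightarrow> real N * q ^ N < \<delta> * a"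
    by (auto simp: eventually_sequentially)
  show ?thesis
  proof (intro exI[of _ N0] allI impI, elim conjE)
    fix N :: nat and V :: "'v set" and nb :: "'v \<Rightarrow> 'v \<Rightarrow> bool"
    assume N: "N0 \<le> N" and V: "finite V"
      and deg: "\<forall>v\<in>V. c * real (card V) \<le> real (card {u \<in> V. nb v u})"
    define B where "B i = {x \<in> {..<N} \<rightarrow>\<^sub>E V. real (card {j \<in> {..<N}. nb (x i) (x j)}) < b * real N}" for i
    have B: "real (card (B i)) \<le> real (card V) ^ N * (q ^ N / a)" if "i < N" for i
    proof -
      have "real (card (B i)) * r powr (b * real N) \<le> real (card V) ^ N * a ^ (N - 1)"
        using card_tuples_low_degree_position[of V "{..<N}" i r c nb b] V r assms that deg
        by (simp add: B_def a_def)
      moreover have "a ^ (N - 1) = a ^ N / a" using that a by (simp add: power_diff)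
      moreover have "r powr (b * real N) = (r powr b) ^ N"
        using r by (simp add: powr_powr[symmetric] powr_realpow)
      ultimately have "real (card (B i)) \<le> real (card V) ^ N * (a ^ N / a) / (r powr b) ^ N"
        using r by (subst pos_le_divide_eq) auto
      then show ?thesis by (simp add: q_def power_divide ac_simps)
    qed
    have "{x \<in> {..<N} \<rightarrow>\<^sub>E V. \<exists>i<N. real (card {j \<in> {..<N}. nb (x i) (x j)}) < b * real N} = (\<Union>i<N. B i)"
      by (auto simp: B_def)
    then have "real (card {x \<in> {..<N} \<rightarrow>\<^sub>E V. \<exists>i<N. real (card {j \<in> {..<N}. nb (x i) (x j)}) < b * real N})
        \<le> (\<Sum>i<N. real (card (B i)))"
      using card_UN_le[of "{..<N}" B] by (simp flip: of_nat_sum)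
    also have "\<dots> \<le> (\<Sum>i<N. real (card V) ^ N * (q ^ N / a))"
      using B by (intro sum_mono) auto
    also have "\<dots> = real (card V) ^ N * (real N * q ^ N / a)" by simp
    also have "\<dots> \<le> real (card V) ^ N * \<delta>"
      using N0[OF N] a by (intro mult_left_mono) (auto simp: field_simps)
    finally show "real (card {x \<in> {..<N} \<rightarrow>\<^sub>E V. \<exists>i<N. real (card {j \<in> {..<N}. nb (x i) (x j)}) < b * real N})
        \<le> \<delta> * real (card V) ^ N" by (simp add: mult.commute)
  qed
qed

subsection \<open>Testing colourability\<close>

text \<open>Sets of vertices are used instead of tuples because repetitions and the order of the
  sampled entries are irrelevant. Failure is monotone in \<open>S\<close>, so failures on different
  blocks of a tuple persist in the whole tuple.\<close>

definition list_colourable :: "'v set set \<Rightarrow> ('v \<Rightarrow> nat set) \<Rightarrow> 'v set \<Rightarrow> bool" where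
  "list_colourable E L S \<longleftrightarrow>
     (\<exists>\<phi>. (\<forall>v\<in>S. \<phi> v \<in> L v) \<and> (\<forall>u\<in>S. \<forall>v\<in>S. {u, v} \<in> E \<longrightarrow> \<phi> u \<noteq> \<phi> v))"

lemma mono_not_list_colourable: "mono (\<lambda>S. \<not> list_colourable E L S)"
proof (rule monoI, unfold le_bool_def, intro impI notI)
  fix S T assume "S \<subseteq> T" and S: "\<not> list_colourable E L S" and "list_colourable E L T"
  then obtain \<phi> where "\<forall>v\<in>T. \<phi> v \<in> L v" "\<forall>u\<in>T. \<forall>v\<in>T. {u, v} \<in> E \<longrightarrow> \<phi> u \<noteq> \<phi> v"
    by (auto simp: list_colourable_def)
  with \<open>S \<subseteq> T\<close> have "list_colourable E L S"
    unfolding list_colourable_def by (intro exI[of _ \<phi>]) (simp add: subset_iff)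
  with S show False ..
qed

text \<open>Concatenation is injective on pairs of tuples, and monotonicity transfers
  \<open>P\<close> and \<open>Q\<close> from the entries of a part to those of the whole. In terms
  of probability, the two blocks are independent.\<close>

lemma card_tuples_append:
  fixes V :: "'v set" and a b :: nat
  assumes "finite V" "mono P" "mono Q"
  shows "card {x \<in> {..<a} \<rightarrow>\<^sub>E V. P (x ` {..<a})} * card {y \<in> {..<b} \<rightarrow>\<^sub>E V. Q (y ` {..<b})}
         \<le> card {z \<in> {..<a + b} \<rightarrow>\<^sub>E V. P (z ` {..<a + b}) \<and> Q (z ` {..<a + b})}"
proof -
  let ?X = "{x \<in> {..<a} \<rightarrow>\<^sub>E V. P (x ` {..<a})}" and ?Y = "{y \<in> {..<b} \<rightarrow>\<^sub>E V. Q (y ` {..<b})}"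
  let ?Z = "{z \<in> {..<a + b} \<rightarrow>\<^sub>E V. P (z ` {..<a + b}) \<and> Q (z ` {..<a + b})}"
  \<comment> \<open>The value \<open>undefined\<close> beyond \<open>a + b\<close> makes the
    concatenation extensional, as membership in the space of tuples requires.\<close>
  define h :: "(nat \<Rightarrow> 'v) \<times> (nat \<Rightarrow> 'v) \<Rightarrow> nat \<Rightarrow> 'v" where
    "h p = (\<lambda>i. if i < a then fst p i else if i < a + b then snd p (i - a) else undefined)" for p
  have h1: "h p i = fst p i" if "i < a" for p i using that by (simp add: h_def)
  have h2: "h p (a + i) = snd p i" if "i < b" for p i using that by (simp add: h_def)
  have "inj_on h (?X \<times> ?Y)"
  proof (rule inj_onI)
    fix p q assume p: "p \<in> ?X \<times> ?Y" and q: "q \<in> ?X \<times> ?Y" and eq: "h p = h q"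
    have "fst p = fst q"
      using p q h1[of _ p] h1[of _ q] eq by (intro PiE_ext[of _ "{..<a}" "\<lambda>_. V"]) (auto simp: mem_Times_iff)
    moreover have "snd p = snd q"
      using p q h2[of _ p] h2[of _ q] eq by (intro PiE_ext[of _ "{..<b}" "\<lambda>_. V"]) (auto simp: mem_Times_iff)
    ultimately show "p = q" by (simp add: prod_eq_iff)
  qed
  moreover have "h ` (?X \<times> ?Y) \<subseteq> ?Z"
  proof
    fix z assume "z \<in> h ` (?X \<times> ?Y)"
    then obtain x y where z: "z = h (x, y)" and x: "x \<in> ?X" and y: "y \<in> ?Y" by auto
    have "x ` {..<a} \<subseteq> z ` {..<a + b}"
    proof
      fix v assume "v \<in> x ` {..<a}"
      then obtain i where "i < a" "v = x i" by auto
      then show "v \<in> z ` {..<a + b}" using h1[of i "(x, y)"] by (auto simp: z intro!: image_eqI[of _ _ i])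
    qed
    moreover have "y ` {..<b} \<subseteq> z ` {..<a + b}"
    proof
      fix v assume "v \<in> y ` {..<b}"
      then obtain i where "i < b" "v = y i" by auto
      then show "v \<in> z ` {..<a + b}" using h2[of i "(x, y)"] by (auto simp: z intro!: image_eqI[of _ _ "a + i"])
    qed
    ultimately have "P (z ` {..<a + b})" "Q (z ` {..<a + b})"
      using x y monoD[OF assms(2)] monoD[OF assms(3)] by (auto simp: le_bool_def)
    moreover have "z \<in> {..<a + b} \<rightarrow>\<^sub>E V"
      using x y by (auto simp: z h_def PiE_def Pi_def extensional_def)
    ultimately show "z \<in> ?Z" by simp
  qed
  moreover have "finite ?Z" using finite_PiE[of "{..<a + b}" "\<lambda>_. V"] assms(1) by auto
  ultimately have "card (?X \<times> ?Y) \<le> card ?Z" by (intro card_inj_on_le)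
  then show ?thesis by (simp add: card_cartesian_product)
qed

text \<open>Concatenation of \<open>k\<close> blocks of length \<open>M\<close>, where block
  \<open>j\<close> takes care of \<open>P j\<close>. In the application there is one block for each
  colour.\<close>

lemma card_tuples_all:
  fixes \<alpha> :: real
  assumes "finite V" "\<And>j. mono (P j)" "\<alpha> \<ge> 0"
    and "\<And>j. j < k \<Longrightarrow> \<alpha> * real (card V) ^ M \<le> real (card {x \<in> {..<M} \<rightarrow>\<^sub>E V. P j (x ` {..<M})})"
  shows "\<alpha> ^ k * real (card V) ^ (k * M)
           \<le> real (card {x \<in> {..<k * M} \<rightarrow>\<^sub>E V. \<forall>j<k. P j (x ` {..<k * M})})"
  using assms(4)
proof (induction k)
  case 0
  then show ?case by simp
next
  case (Suc k)
  let ?A = "{x \<in> {..<k * M} \<rightarrow>\<^sub>E V. \<forall>j<k. P j (x ` {..<k * M})}"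
  let ?B = "{x \<in> {..<M} \<rightarrow>\<^sub>E V. P k (x ` {..<M})}"
  have mono: "mono (\<lambda>S. \<forall>j<k. P j S)"
    using assms(2) unfolding mono_def le_bool_def by blast
  have "\<alpha> ^ Suc k * real (card V) ^ (Suc k * M)
      = (\<alpha> ^ k * real (card V) ^ (k * M)) * (\<alpha> * real (card V) ^ M)"
    by (simp add: power_add algebra_simps)
  also have "\<dots> \<le> real (card ?A) * real (card ?B)"
    using Suc assms(3) by (intro mult_mono) auto
  also have "\<dots> \<le> real (card {x \<in> {..<k * M + M} \<rightarrow>\<^sub>E V.
                 (\<forall>j<k. P j (x ` {..<k * M + M})) \<and> P k (x ` {..<k * M + M})})"
    using card_tuples_append[OF assms(1) mono assms(2)[of k], of "k * M" M]
    by (simp only: of_nat_mult[symmetric] of_nat_le_iff)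
  also have "\<dots> = real (card {x \<in> {..<Suc k * M} \<rightarrow>\<^sub>E V. \<forall>j<Suc k. P j (x ` {..<Suc k * M})})"
    by (simp add: less_Suc_eq add.commute[of M] conj_commute all_conj_distrib disj_imp) (metis)
  finally show ?case .
qed

text \<open>
  The list \<open>L v\<close> consists of the colours still available at \<open>v\<close>. If a vertex has an available colour that is
  available at few of its neighbours, then giving it this colour creates few monochromatic edges.
\<close>
lemma many_restricting_vertices:
  fixes G :: "'v ugraph" and \<epsilon> :: real
  defines "n \<equiv> real (graph_order G)"
  assumes G: "simple_graph G" and "k > 0" "\<epsilon> \<ge> 0" and L: "\<And>v. L v \<subseteq> {..<k}"
    and far: "\<not> (\<exists>F\<subseteq>edges G. real (card F) \<le> 2 * \<epsilon> * n\<^sup>2 \<and> colourable k (delete_edges G F))"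
  shows "real (card {v \<in> verts G. \<forall>j\<in>L v. real (card {w \<in> verts G. {v, w} \<in> edges G \<and> j \<in> L w}) > \<epsilon> * n})
           > \<epsilon> * n"
proof (rule ccontr)
  define V where "V = verts G"
  define N where "N v j = {w \<in> V. {v, w} \<in> edges G \<and> j \<in> L w}" for v j
  define B where "B = {v \<in> V. \<forall>j\<in>L v. real (card (N v j)) > \<epsilon> * n}"
  assume "\<not> ?thesis"
  then have B: "real (card B) \<le> \<epsilon> * n" by (simp add: B_def N_def V_def)
  have V: "finite V" "n = real (card V)" using G by (auto simp: simple_graph_def V_def n_def graph_order_def)
  have BV: "B \<subseteq> V" "finite B" using V by (auto simp: B_def)
  have "\<forall>v\<in>V - B. \<exists>j\<in>L v. real (card (N v j)) \<le> \<epsilon> * n" by (auto simp: B_def not_less)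
  then obtain \<psi> where \<psi>: "\<And>v. v \<in> V - B \<Longrightarrow> \<psi> v \<in> L v \<and> real (card (N v (\<psi> v))) \<le> \<epsilon> * n"
    by metis
  \<comment> \<open>Vertices of \<open>B\<close> receive the arbitrary colour 0, which exists since
    \<open>k > 0\<close>; every edge at \<open>B\<close> is allowed to be monochromatic.\<close>
  define \<chi> where "\<chi> v = (if v \<in> B then 0 else \<psi> v)" for v
  define F where "F = {e \<in> edges G. \<exists>u v. e = {u, v} \<and> \<chi> u = \<chi> v}"
  \<comment> \<open>These ordered pairs cover the monochromatic edges. Outside \<open>B\<close> the
    common colour of \<open>u\<close> and \<open>v\<close> comes from the list of \<open>v\<close>,
    so \<open>v\<close> is among the few vertices counted for \<open>u\<close>. Each of the two
    parts of \<open>Q\<close> has size at most \<epsilon> times \<open>n * n\<close>, whence the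
    factor 2 in the hypothesis.\<close>
  define Q where "Q = B \<times> V \<union> (SIGMA v:V - B. N v (\<psi> v))"
  have finN: "finite (N v j)" for v j using V by (simp add: N_def)
  have "F \<subseteq> (\<lambda>(u, v). {u, v}) ` Q"
  proof
    fix e assume "e \<in> F"
    then obtain u v where e: "{u, v} \<in> edges G" "e = {u, v}" "\<chi> u = \<chi> v" by (auto simp: F_def)
    then have uv: "u \<in> V" "v \<in> V" using G by (auto simp: simple_graph_def V_def)
    consider "u \<in> B" | "v \<in> B" | "u \<notin> B" "v \<notin> B" by blast
    then show "e \<in> (\<lambda>(u, v). {u, v}) ` Q"
    proof cases
      case 1
      then show ?thesis using uv e by (intro image_eqI[of _ _ "(u, v)"]) (auto simp: Q_def)
    next
      case 2
      then show ?thesis using uv e by (intro image_eqI[of _ _ "(v, u)"]) (auto simp: Q_def)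
    next
      case 3
      then have "\<psi> u \<in> L v" using e(3) uv \<psi>[of v] by (simp add: \<chi>_def)
      then show ?thesis using 3 uv e
        by (intro image_eqI[of _ _ "(u, v)"]) (auto simp: Q_def N_def)
    qed
  qed
  moreover have finQ: "finite Q" using BV V finN by (auto simp: Q_def)
  ultimately have "card F \<le> card Q" by (rule surj_card_le[rotated])
  also have "card Q \<le> card (B \<times> V) + card (SIGMA v:V - B. N v (\<psi> v))"
    unfolding Q_def by (rule card_Un_le)
  also have "\<dots> = card B * card V + (\<Sum>v\<in>V - B. card (N v (\<psi> v)))"
    using V finN by (simp add: card_cartesian_product card_SigmaI)
  finally have "real (card F) \<le> real (card B) * n + (\<Sum>v\<in>V - B. real (card (N v (\<psi> v))))"
    unfolding V(2) by (simp flip: of_nat_mult of_nat_sum of_nat_add)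
  also have "\<dots> \<le> \<epsilon> * n * n + (\<Sum>v\<in>V - B. \<epsilon> * n)"
    using B \<psi> V(2) by (intro add_mono mult_right_mono sum_mono) auto
  also have "(\<Sum>v\<in>V - B. \<epsilon> * n) \<le> (\<Sum>v\<in>V. \<epsilon> * n)"
    using V \<open>\<epsilon> \<ge> 0\<close> by (intro sum_mono2) auto
  also have "\<epsilon> * n * n + \<dots> = 2 * \<epsilon> * n\<^sup>2" using V(2) by (simp add: power2_eq_square)
  finally have "real (card F) \<le> 2 * \<epsilon> * n\<^sup>2" by simp
  moreover have "colourable k (delete_edges G F)"
  proof -
    have "\<chi> ` V \<subseteq> {..<k}" using \<psi> L \<open>k > 0\<close> by (fastforce simp: \<chi>_def)
    moreover have "\<chi> u \<noteq> \<chi> v" if "{u, v} \<in> edges G - F" for u v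
      using that by (auto simp: F_def)
    ultimately show ?thesis unfolding colourable_def by (auto simp: delete_edges_def V_def)
  qed
  moreover have "F \<subseteq> edges G" by (auto simp: F_def)
  ultimately show False using far by blast
qed

text \<open>The potential drops by one at each affected vertex. When \<open>Q\<close> is adjacency
  to a restricting vertex, the drop exceeds \<epsilon> times \<open>n\<close>.\<close>

lemma sum_card_remove_colour:
  fixes L :: "'v \<Rightarrow> nat set"
  assumes "finite V" "\<And>v. finite (L v)"
  shows "(\<Sum>w\<in>V. card (if Q w then L w - {j} else L w)) + card {w \<in> V. Q w \<and> j \<in> L w} = (\<Sum>w\<in>V. card (L w))"
proof -
  have "card {w \<in> V. Q w \<and> j \<in> L w} = (\<Sum>w\<in>V. if Q w \<and> j \<in> L w then 1 else 0)"
    using assms(1) by (simp add: sum.If_cases Int_def)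
  then have "(\<Sum>w\<in>V. card (if Q w then L w - {j} else L w)) + card {w \<in> V. Q w \<and> j \<in> L w}
      = (\<Sum>w\<in>V. card (if Q w then L w - {j} else L w) + (if Q w \<and> j \<in> L w then 1 else 0))"
    by (simp add: sum.distrib)
  also have "\<dots> = (\<Sum>w\<in>V. card (L w))"
    using assms(2) card_Suc_Diff1 by (intro sum.cong) (fastforce)+
  finally show ?thesis .
qed

text \<open>A list colouring of \<open>insert v S\<close> gives \<open>v\<close> some colour
  \<open>j\<close> of its list, and on \<open>S\<close> it avoids \<open>j\<close> at all neighbours
  of \<open>v\<close>. In particular, an empty list at \<open>v\<close> rules out every
  colouring.\<close>

lemma not_list_colourable_insert:
  assumes "\<And>j. j \<in> L v \<Longrightarrow>
      \<not> list_colourable E (\<lambda>w. if {v, w} \<in> E then L w - {j} else L w) S"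
  shows "\<not> list_colourable E L (insert v S)"
proof
  assume "list_colourable E L (insert v S)"
  then obtain \<phi> where \<phi>: "\<forall>w\<in>insert v S. \<phi> w \<in> L w"
    "\<forall>u\<in>insert v S. \<forall>w\<in>insert v S. {u, w} \<in> E \<longrightarrow> \<phi> u \<noteq> \<phi> w"
    unfolding list_colourable_def by blast
  then have "list_colourable E (\<lambda>w. if {v, w} \<in> E then L w - {\<phi> v} else L w) S"
    unfolding list_colourable_def by (intro exI[of _ \<phi>]) auto
  with assms[of "\<phi> v"] \<phi>(1) show False by simp
qed

text \<open>
  Induction on the total size of the lists, in units of \<open>\<epsilon> n\<close>: a restricting vertex \<open>v\<close> is added to one
  block of vertices for each colour \<open>j\<close>, where the block for \<open>j\<close> has no list colouring once \<open>v\<close> has colour \<open>j\<close>.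
\<close>
lemma many_uncolourable_tuples:
  fixes \<epsilon> :: real
  assumes "k > 0" "0 < \<epsilon>" "\<epsilon> \<le> 1"
  shows "\<exists>M \<alpha>. 0 < \<alpha> \<and> \<alpha> \<le> 1 \<and>
    (\<forall>(G :: 'v ugraph) L. simple_graph G \<and> verts G \<noteq> {} \<and> (\<forall>v. L v \<subseteq> {..<k}) \<and>
       real (\<Sum>v\<in>verts G. card (L v)) \<le> real d * (\<epsilon> * real (graph_order G)) \<and>
       \<not> (\<exists>F\<subseteq>edges G. real (card F) \<le> 2 * \<epsilon> * (real (graph_order G))\<^sup>2 \<and> colourable k (delete_edges G F)) \<longrightarrow>
       \<alpha> * real (graph_order G) ^ M
         \<le> real (card {x \<in> {..<M} \<rightarrow>\<^sub>E verts G. \<not> list_colourable (edges G) L (x ` {..<M})}))"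
proof (induction d)
  case 0
  show ?case
  \<comment> \<open>Total size 0 empties every list, so any single entry is an obstruction. Length 0
    would not do, as the empty set always has a list colouring.\<close>
  proof (intro exI[of _ "1::nat"] exI[of _ "1::real"] conjI allI impI; (elim conjE)?)
    fix G :: "'v ugraph" and L :: "'v \<Rightarrow> nat set"
    assume G: "simple_graph G" "\<forall>v. L v \<subseteq> {..<k}"
      "real (\<Sum>v\<in>verts G. card (L v)) \<le> real 0 * (\<epsilon> * real (graph_order G))"
    have V: "finite (verts G)" using G by (simp add: simple_graph_def)
    have "(\<Sum>v\<in>verts G. card (L v)) = 0" using G(3) by (simp del: of_nat_sum)
    then have "L v = {}" if "v \<in> verts G" for v
      using G(2) V that finite_subset[of "L v" "{..<k}"] by auto
    then have "\<not> list_colourable (edges G) L (x ` {..<1})" if "x \<in> {..<1::nat} \<rightarrow>\<^sub>E verts G" for x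
      using that unfolding list_colourable_def by (force simp: PiE_iff)
    then have "{x \<in> {..<1::nat} \<rightarrow>\<^sub>E verts G. \<not> list_colourable (edges G) L (x ` {..<1})} = {..<1} \<rightarrow>\<^sub>E verts G"
      by blast
    then show "1 * real (graph_order G) ^ 1
        \<le> real (card {x \<in> {..<1::nat} \<rightarrow>\<^sub>E verts G. \<not> list_colourable (edges G) L (x ` {..<1})})"
      by (simp add: card_funcsetE graph_order_def del: One_nat_def)
  qed auto
next
  case (Suc d)
  then obtain M \<alpha> where \<alpha>: "0 < \<alpha>" "\<alpha> \<le> 1" and IH:
    "\<forall>(G :: 'v ugraph) L. simple_graph G \<and> verts G \<noteq> {} \<and> (\<forall>v. L v \<subseteq> {..<k}) \<and>
       real (\<Sum>v\<in>verts G. card (L v)) \<le> real d * (\<epsilon> * real (graph_order G)) \<and>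
       \<not> (\<exists>F\<subseteq>edges G. real (card F) \<le> 2 * \<epsilon> * (real (graph_order G))\<^sup>2 \<and> colourable k (delete_edges G F)) \<longrightarrow>
       \<alpha> * real (graph_order G) ^ M
         \<le> real (card {x \<in> {..<M} \<rightarrow>\<^sub>E verts G. \<not> list_colourable (edges G) L (x ` {..<M})})"
    by (elim exE conjE) 
  \<comment> \<open>There is one block of length \<open>M\<close> for each of the \<open>k\<close>
    colours; the coordinate after them holds the restricting vertex. In the new density, \<epsilon>
    accounts for this vertex and the power of \<alpha> for the blocks.\<close>
  define m where "m = k * M"
  show ?case
  proof (intro exI[of _ "Suc m"] exI[of _ "\<epsilon> * \<alpha> ^ k"] conjI allI impI; (elim conjE)?)
    show "0 < \<epsilon> * \<alpha> ^ k" using \<alpha> assms by simp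
    show "\<epsilon> * \<alpha> ^ k \<le> 1" using \<alpha> assms by (intro mult_le_one power_le_one) auto
    fix G :: "'v ugraph" and L :: "'v \<Rightarrow> nat set"
    assume G: "simple_graph G" "verts G \<noteq> {}" and L: "\<forall>v. L v \<subseteq> {..<k}"
      and pot: "real (\<Sum>v\<in>verts G. card (L v)) \<le> real (Suc d) * (\<epsilon> * real (graph_order G))"
      and far: "\<not> (\<exists>F\<subseteq>edges G. real (card F) \<le> 2 * \<epsilon> * (real (graph_order G))\<^sup>2 \<and> colourable k (delete_edges G F))"
    define V E n where "V = verts G" and "E = edges G" and "n = real (graph_order G)"
    define B where "B = {v \<in> V. \<forall>j\<in>L v. real (card {w \<in> V. {v, w} \<in> E \<and> j \<in> L w}) > \<epsilon> * n}"
    have V: "finite V" "n = real (card V)" using G by (auto simp: simple_graph_def V_def n_def graph_order_def)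
    have Bc: "real (card B) \<ge> \<epsilon> * n"
      using many_restricting_vertices[OF G(1) assms(1) _ _ far, of L] assms(2) L
      by (simp add: B_def V_def E_def n_def)
    define L' where "L' v j = (\<lambda>w. if {v, w} \<in> E then L w - {j} else L w)" for v j
    have finL: "finite (L v)" for v using L finite_subset[of "L v" "{..<k}"] by auto
    \<comment> \<open>For a colour missing from the list of \<open>v\<close> the condition is
      vacuous and the bound follows from \<alpha> being at most 1. This lets all \<open>k\<close>
      colours be treated alike.\<close>
    have step: "\<alpha> * real (card V) ^ M \<le> real (card {x \<in> {..<M} \<rightarrow>\<^sub>E V. j \<in> L v \<longrightarrow> \<not> list_colourable E (L' v j) (x ` {..<M})})"
      if v: "v \<in> B" for v j
    proof (cases "j \<in> L v")
      case True
      have "real (\<Sum>w\<in>V. card (L' v j w)) + \<epsilon> * n \<le> real (\<Sum>w\<in>V. card (L w))"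
      proof -
        have "\<epsilon> * n < real (card {w \<in> V. {v, w} \<in> E \<and> j \<in> L w})" using v True by (auto simp: B_def)
        then show ?thesis
          using sum_card_remove_colour[where V = V and L = L and j = j and Q = "\<lambda>w. {v, w} \<in> E", OF V(1) finL]
          unfolding L'_def by linarith
      qed
      then have "real (\<Sum>w\<in>V. card (L' v j w)) \<le> real d * (\<epsilon> * n)"
        using pot by (simp add: V_def n_def algebra_simps)
      moreover have "\<forall>w. L' v j w \<subseteq> {..<k}" using L by (auto simp: L'_def)
      ultimately have "\<alpha> * n ^ M \<le> real (card {x \<in> {..<M} \<rightarrow>\<^sub>E V. \<not> list_colourable E (L' v j) (x ` {..<M})})"
        using IH[rule_format, of G "L' v j"] G far unfolding V_def E_def n_def by blast
      then show ?thesis using True V(2) by simp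
    next
      case False
      then show ?thesis using \<alpha> V by (simp add: card_funcsetE mult_left_le_one_le)
    qed
    have mono: "mono (\<lambda>S. j \<in> L v \<longrightarrow> \<not> list_colourable E (L' v j) S)" for v j
      using mono_not_list_colourable[of E "L' v j"] unfolding mono_def le_bool_def by blast
    define D where "D v = {y \<in> {..<m} \<rightarrow>\<^sub>E V. \<forall>j<k. j \<in> L v \<longrightarrow> \<not> list_colourable E (L' v j) (y ` {..<m})}" for v
    have D: "\<alpha> ^ k * n ^ m \<le> real (card (D v))" if "v \<in> B" for v
      using card_tuples_all[of V "\<lambda>j S. j \<in> L v \<longrightarrow> \<not> list_colourable E (L' v j) S" \<alpha> k M]
        V mono \<alpha> step[OF that] unfolding D_def m_def by simp
    define R where "R = {x \<in> {..<Suc m} \<rightarrow>\<^sub>E V. \<not> list_colourable E L (x ` {..<Suc m})}"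
    have DR: "D v \<subseteq> {y \<in> {..<m} \<rightarrow>\<^sub>E V. y(m := v) \<in> R}" if "v \<in> B" for v
    proof
      fix y assume y: "y \<in> D v"
      have "(y(m := v)) ` {..<Suc m} = insert v (y ` {..<m})"
        by (auto simp: lessThan_Suc image_def)
      moreover have "\<not> list_colourable E L (insert v (y ` {..<m}))"
        using y L by (intro not_list_colourable_insert) (auto simp: D_def L'_def)
      moreover have "y(m := v) \<in> {..<Suc m} \<rightarrow>\<^sub>E V"
        using y that by (auto simp: D_def B_def PiE_def Pi_def extensional_def less_Suc_eq)
      ultimately show "y \<in> {y \<in> {..<m} \<rightarrow>\<^sub>E V. y(m := v) \<in> R}"
        using y by (simp add: R_def D_def)
    qed
    have fin: "finite ({..<m} \<rightarrow>\<^sub>E V)" using V by (auto intro: finite_PiE)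
    have "\<epsilon> * \<alpha> ^ k * n ^ Suc m = (\<epsilon> * n) * (\<alpha> ^ k * n ^ m)" by simp
    also have "\<dots> \<le> real (card B) * (\<alpha> ^ k * n ^ m)"
      using Bc \<alpha> V by (intro mult_right_mono) auto
    also have "\<dots> = (\<Sum>v\<in>B. \<alpha> ^ k * n ^ m)" by simp
    also have "\<dots> \<le> (\<Sum>v\<in>B. real (card {y \<in> {..<m} \<rightarrow>\<^sub>E V. y(m := v) \<in> R}))"
    proof (rule sum_mono)
      fix v assume v: "v \<in> B"
      have "card (D v) \<le> card {y \<in> {..<m} \<rightarrow>\<^sub>E V. y(m := v) \<in> R}"
        using fin DR[OF v] by (intro card_mono) auto
      then show "\<alpha> ^ k * n ^ m \<le> real (card {y \<in> {..<m} \<rightarrow>\<^sub>E V. y(m := v) \<in> R})"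
        using D[OF v] by linarith
    qed
    also have "\<dots> \<le> (\<Sum>v\<in>V. real (card {y \<in> {..<m} \<rightarrow>\<^sub>E V. y(m := v) \<in> R}))"
      using V by (intro sum_mono2) (auto simp: B_def)
    also have "\<dots> = real (card R)"
      using card_tuples_insert[of "{..<m}" V m R] V by (simp add: R_def lessThan_Suc)
    finally show "\<epsilon> * \<alpha> ^ k * real (graph_order G) ^ Suc m
        \<le> real (card {x \<in> {..<Suc m} \<rightarrow>\<^sub>E verts G. \<not> list_colourable (edges G) L (x ` {..<Suc m})})"
      unfolding R_def V_def E_def n_def .
  qed
qed

subsection \<open>From homomorphism thresholds to approximate thresholds\<close>

lemma min_degree_ge_iff:
  assumes "simple_graph G" "verts G \<noteq> {}"
  shows "r \<le> real (min_degree G) \<longleftrightarrow> (\<forall>v\<in>verts G. r \<le> real (vertex_degree G v))"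
proof -
  have fin: "finite (vertex_degree G ` verts G)" using assms by (simp add: simple_graph_def)
  then have "min_degree G \<in> vertex_degree G ` verts G"
    unfolding min_degree_def using assms by (intro Min_in) auto
  moreover have "min_degree G \<le> vertex_degree G v" if "v \<in> verts G" for v
    unfolding min_degree_def using fin that by (intro Min_le) auto
  ultimately show ?thesis by (smt (verit) image_iff of_nat_le_iff)
qed

lemma vertex_degree_le_order:
  assumes "simple_graph G"
  shows "vertex_degree G v \<le> graph_order G"
  using assms unfolding vertex_degree_def graph_order_def simple_graph_def by (intro card_mono) auto

lemma colourable_if_no_verts:
  assumes "simple_graph G" "verts G = {}"
  shows "colourable k G"
proof -
  have "edges G = {}" using assms by (fastforce simp: simple_graph_def)
  with assms show ?thesis by (simp add: colourable_def)
qed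

lemma edge_vertices:
  assumes "simple_graph G" "{u, v} \<in> edges G"
  shows "u \<in> verts G" "v \<in> verts G" "u \<noteq> v"
  using assms by (auto simp: simple_graph_def)

lemma not_graph_free_if_injective_homomorphism:
  assumes H: "simple_graph H" and y: "inj_on y (verts H)" "y ` verts H \<subseteq> verts G"
    and hom: "\<And>u v. {u, v} \<in> edges H \<Longrightarrow> {y u, y v} \<in> edges G"
  shows "\<not> graph_free H G"
proof -
  define K where "K = \<lparr>verts = y ` verts H, edges = (\<lambda>e. y ` e) ` edges H\<rparr>"
  have sub: "e \<subseteq> verts H" and two: "card e = 2" if "e \<in> edges H" for e
    using H that by (auto simp: simple_graph_def)
  have "card (y ` e) = 2" if "e \<in> edges H" for e
    using card_image[OF inj_on_subset[OF y(1) sub[OF that]]] two[OF that] by simp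
  then have "simple_graph K"
    using H sub by (auto simp: simple_graph_def K_def)
  moreover have "edges K \<subseteq> edges G"
  proof
    fix e' assume "e' \<in> edges K"
    then obtain e where e: "e \<in> edges H" "e' = y ` e" by (auto simp: K_def)
    then obtain u v where "e = {u, v}" using two card_2_iff by metis
    then show "e' \<in> edges G" using e hom by auto
  qed
  moreover have "{u, v} \<in> edges H \<longleftrightarrow> {y u, y v} \<in> edges K" if "u \<in> verts H" "v \<in> verts H" for u v
  proof
    assume "{y u, y v} \<in> edges K"
    then obtain e where e: "e \<in> edges H" "y ` {u, v} = y ` e" by (auto simp: K_def)
    then have "{u, v} = e"
      using inj_on_image_eq_iff[OF y(1) _ sub[OF e(1)], of "{u, v}"] that by simp
    with e show "{u, v} \<in> edges H" by simp
  qed (auto simp: K_def intro: image_eqI[of _ _ "{u, v}"])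
  moreover have "bij_betw y (verts H) (verts K)"
    using y by (simp add: bij_betw_def K_def)
  moreover have "verts K \<subseteq> verts G" using y by (simp add: K_def)
  ultimately show ?thesis
    unfolding graph_free_def subgraph_def isomorphic_def by blast
qed

text \<open>The vertices are the positions of the tuple, so a repeated entry yields non-adjacent twins.\<close>
definition tuple_graph :: "'v ugraph \<Rightarrow> nat \<Rightarrow> (nat \<Rightarrow> 'v) \<Rightarrow> nat ugraph" where
  "tuple_graph G N x =
     \<lparr>verts = {..<N}, edges = {{i, j} | i j. i < N \<and> j < N \<and> {x i, x j} \<in> edges G}\<rparr>"

lemma verts_tuple_graph [simp]: "verts (tuple_graph G N x) = {..<N}"
  by (simp add: tuple_graph_def)

lemma edges_tuple_graph_iff:
  "{i, j} \<in> edges (tuple_graph G N x) \<longleftrightarrow> i < N \<and> j < N \<and> {x i, x j} \<in> edges G"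
  by (auto simp: tuple_graph_def doubleton_eq_iff insert_commute)

lemma simple_graph_tuple_graph:
  assumes "simple_graph G"
  shows "simple_graph (tuple_graph G N x)"
proof -
  have "i \<noteq> j" if "{x i, x j} \<in> edges G" for i j
    using edge_vertices(3)[OF assms that] by auto
  then have "card {i, j} = 2" if "{x i, x j} \<in> edges G" for i j
    using that by simp
  then show ?thesis by (auto simp: simple_graph_def tuple_graph_def)
qed

text \<open>Each entry inherits the colour of one chosen position at which it occurs.
  Contrapositively, an uncolourable set of entries gives a tuple graph that is not
  \<open>k\<close>-colourable.\<close>

lemma list_colourable_if_colourable_tuple_graph:
  assumes "colourable k (tuple_graph G N x)"
  shows "list_colourable (edges G) (\<lambda>_. {..<k}) (x ` {..<N})"
proof -
  obtain c where c: "c ` {..<N} \<subseteq> {..<k}"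
    "\<And>i j. {i, j} \<in> edges (tuple_graph G N x) \<Longrightarrow> c i \<noteq> c j"
    using assms by (auto simp: colourable_def)
  define s where "s = inv_into {..<N} x"
  have s: "s v < N" "x (s v) = v" if "v \<in> x ` {..<N}" for v
    using inv_into_into[OF that] f_inv_into_f[OF that] by (auto simp: s_def)
  show ?thesis unfolding list_colourable_def
  proof (intro exI[of _ "c \<circ> s"] conjI ballI impI)
    fix v assume "v \<in> x ` {..<N}"
    then show "(c \<circ> s) v \<in> {..<k}" using c(1) s(1) by auto
  next
    fix u v assume uv: "u \<in> x ` {..<N}" "v \<in> x ` {..<N}" "{u, v} \<in> edges G"
    then have "{s u, s v} \<in> edges (tuple_graph G N x)" using s by (simp add: edges_tuple_graph_iff)
    from c(2)[OF this] show "(c \<circ> s) u \<noteq> (c \<circ> s) v" by simp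
  qed
qed

text \<open>Otherwise, by pigeonhole, a single map \<open>f\<close> from \<open>H\<close> to
  positions works for a dense set of tuples. This set contains a box with sides of size
  \<open>card (verts H)\<close>, and distinct representatives from its sides form a copy of
  \<open>H\<close> in \<open>G\<close>.\<close>

lemma graph_free_few_homomorphic_tuples:
  fixes H :: "'a ugraph" and \<beta> :: real
  assumes H: "simple_graph H" and "\<beta> > 0"
  shows "\<exists>n0. \<forall>G :: 'v ugraph. simple_graph G \<and> graph_order G \<ge> n0 \<and> graph_free H G \<longrightarrow>
           real (card {x \<in> {..<N} \<rightarrow>\<^sub>E verts G. homomorphic H (tuple_graph G N x)})
             < \<beta> * real (graph_order G) ^ N"
proof -
  define h where "h = card (verts H)"
  have finH: "finite (verts H)" using H by (simp add: simple_graph_def)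
  \<comment> \<open>The power of \<open>Suc N\<close> counts candidate maps into
    \<open>{..<Suc N}\<close>, a range that is nonempty even for \<open>N = 0\<close>, as the
    pigeonhole principle needs.\<close>
  define \<gamma> where "\<gamma> = \<beta> / real (Suc N) ^ h"
  have "\<gamma> > 0" using assms by (simp add: \<gamma>_def)
  from dense_relation_contains_box[OF finite_lessThan this, of N h] obtain n1 where n1:
    "\<forall>V :: 'v set. \<forall>R. finite V \<and> card V \<ge> n1 \<and> R \<subseteq> {..<N} \<rightarrow>\<^sub>E V \<and>
       real (card R) \<ge> \<gamma> * real (card V) ^ card {..<N} \<longrightarrow>
       (\<exists>A. (\<forall>j\<in>{..<N}. A j \<subseteq> V \<and> card (A j) = h) \<and> PiE {..<N} A \<subseteq> R)" ..
  show ?thesis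
  proof (intro exI[of _ "max 1 n1"] allI impI, elim conjE, rule ccontr)
    fix G :: "'v ugraph"
    assume G: "simple_graph G" and n: "max 1 n1 \<le> graph_order G" and free: "graph_free H G"
    define X where "X = {x \<in> {..<N} \<rightarrow>\<^sub>E verts G. homomorphic H (tuple_graph G N x)}"
    assume "\<not> real (card {x \<in> {..<N} \<rightarrow>\<^sub>E verts G. homomorphic H (tuple_graph G N x)})
             < \<beta> * real (graph_order G) ^ N"
    then have Xc: "real (card X) \<ge> \<beta> * real (graph_order G) ^ N" by (simp add: X_def)
    have V: "finite (verts G)" "card (verts G) = graph_order G" "real (graph_order G) > 0"
      using G n by (auto simp: simple_graph_def graph_order_def)
    have finX: "finite X" using V finite_PiE[of "{..<N}" "\<lambda>_. verts G"] by (auto simp: X_def)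
    have "\<exists>f. f \<in> verts H \<rightarrow>\<^sub>E {..<Suc N} \<and> f ` verts H \<subseteq> {..<N} \<and>
            (\<forall>u v. {u, v} \<in> edges H \<longrightarrow> {x (f u), x (f v)} \<in> edges G)" if x: "x \<in> X" for x
    proof -
      obtain f where f: "f ` verts H \<subseteq> {..<N}"
        "\<And>u v. {u, v} \<in> edges H \<Longrightarrow> {f u, f v} \<in> edges (tuple_graph G N x)"
        using x unfolding X_def homomorphic_def verts_tuple_graph by blast
      have "{x (restrict f (verts H) u), x (restrict f (verts H) v)} \<in> edges G" if "{u, v} \<in> edges H" for u v
        using f(2)[OF that] edge_vertices[OF H that] by (simp add: edges_tuple_graph_iff)
      moreover have "restrict f (verts H) \<in> verts H \<rightarrow>\<^sub>E {..<Suc N}" using f(1) by fastforce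
      moreover have "restrict f (verts H) ` verts H \<subseteq> {..<N}" using f(1) by auto
      ultimately show ?thesis by blast
    qed
    then obtain F where F: "\<And>x. x \<in> X \<Longrightarrow> F x \<in> verts H \<rightarrow>\<^sub>E {..<Suc N} \<and> F x ` verts H \<subseteq> {..<N} \<and>
            (\<forall>u v. {u, v} \<in> edges H \<longrightarrow> {x (F x u), x (F x v)} \<in> edges G)" by metis
    have "F \<in> X \<rightarrow> (verts H \<rightarrow>\<^sub>E {..<Suc N})" using F by blast
    from pigeonhole_card[OF this finX] obtain f where
      f: "card X \<le> card (F -` {f} \<inter> X) * card (verts H \<rightarrow>\<^sub>E {..<Suc N})"
      using finH by (auto simp: finite_PiE PiE_eq_empty_iff)
    define R where "R = F -` {f} \<inter> X"
    have "\<beta> * real (graph_order G) ^ N \<le> real (card R * Suc N ^ h)"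
      using Xc f finH unfolding R_def h_def card_funcsetE[OF finH] card_lessThan by linarith
    then have Rc: "\<gamma> * real (graph_order G) ^ N \<le> real (card R)"
      by (simp add: \<gamma>_def divide_le_eq)
    have "real (card R) > 0"
      by (rule less_le_trans[OF _ Rc]) (use \<open>\<gamma> > 0\<close> V in simp)
    then obtain x0 where x0: "x0 \<in> R" by (auto simp: card_gt_0_iff)
    have fR: "{x (f u), x (f v)} \<in> edges G" if "x \<in> R" "{u, v} \<in> edges H" for x u v
      using F[of x] that by (auto simp: R_def)
    have fN: "f u < N" if "u \<in> verts H" for u using F[of x0] x0 that by (auto simp: R_def)
    have "R \<subseteq> {..<N} \<rightarrow>\<^sub>E verts G" by (auto simp: R_def X_def)
    then obtain A where "\<forall>j\<in>{..<N}. A j \<subseteq> verts G \<and> card (A j) = h" and box: "PiE {..<N} A \<subseteq> R"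
      using n1[rule_format, of "verts G" R] V n Rc by auto
    then have A: "A j \<subseteq> verts G \<and> card (A j) = h" if "j < N" for j using that by simp
    obtain y where y: "inj_on y (verts H)" "\<And>u. u \<in> verts H \<Longrightarrow> y u \<in> A (f u)"
      using distinct_representatives_of_large_sets[OF finH, of "A \<circ> f"] A fN by (auto simp: h_def)
    have "{y u, y v} \<in> edges G" if uv: "{u, v} \<in> edges H" for u v
    proof -
      note uvH = edge_vertices[OF H uv]
      have "f u \<noteq> f v" using edge_vertices(3)[OF G fR[OF x0 uv]] by auto
      define a where "a j = (SOME w. w \<in> A j)" for j
      have a: "a j \<in> A j" if "j < N" for j
      proof -
        have "A j \<noteq> {}" using A[OF that] uvH(1) finH by (auto simp: h_def)
        then show ?thesis by (simp add: a_def some_in_eq)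
      qed
      \<comment> \<open>To verify one edge, \<open>y u\<close> and \<open>y v\<close> are put at the
        positions \<open>f u\<close> and \<open>f v\<close>, which differ, and the other entries are
        arbitrary in the box. Then \<open>z\<close> lies in \<open>R\<close>, so \<open>f\<close>
        maps the edge correctly.\<close>
      define z where "z = (\<lambda>i\<in>{..<N}. (a(f u := y u, f v := y v)) i)"
      have "z \<in> PiE {..<N} A"
        using a y(2) uvH fN by (auto simp: z_def)
      with box have "z \<in> R" by blast
      from fR[OF this uv] show ?thesis
        using fN uvH \<open>f u \<noteq> f v\<close> by (simp add: z_def)
    qed
    moreover have "y ` verts H \<subseteq> verts G" using y(2) A fN by blast
    ultimately show False
      using not_graph_free_if_injective_homomorphism[OF H y(1)] free by blast
  qed
qed

text \<open>The gap between \<open>b\<close> and \<open>c\<close> pays for the degree lost by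
  sampling. At least a fraction \<alpha> of the tuples is uncolourable; low degrees and homomorphic
  images of \<open>H\<close> would together have to account for all of these, but cover less than
  half of \<alpha> each or exactly half at most in the first case.\<close>

lemma approx_threshold_of_hom_threshold:
  fixes H :: "'a ugraph" and b c \<eta> :: real
  assumes H: "simple_graph H" and "k > 0" "0 \<le> b" "b < c" "\<eta> > 0"
    and hom: "\<And>G :: nat ugraph. simple_graph G \<Longrightarrow> real (min_degree G) \<ge> b * real (graph_order G) \<Longrightarrow>
                \<not> homomorphic H G \<Longrightarrow> colourable k G"
  shows "\<exists>n0::nat. \<forall>G :: 'v ugraph.
          simple_graph G \<and> graph_order G \<ge> n0 \<and> graph_free H G \<and>
          real (min_degree G) \<ge> c * real (graph_order G) \<longrightarrow>
          (\<exists>F\<subseteq>edges G. real (card F) \<le> \<eta> * (real (graph_order G))\<^sup>2 \<and>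
                         colourable k (delete_edges G F))"
proof (cases "c \<le> 1")
  \<comment> \<open>No graph with a vertex has minimum degree above its order, so the claim is
    vacuous from order 1 on.\<close>
  case False
  have "\<not> real (min_degree G) \<ge> c * real (graph_order G)" if G: "simple_graph G" "graph_order G \<ge> 1" for G :: "'v ugraph"
  proof
    assume *: "real (min_degree G) \<ge> c * real (graph_order G)"
    obtain v where v: "v \<in> verts G" using G by (force simp: graph_order_def)
    have "c * real (graph_order G) \<le> real (vertex_degree G v)"
      using * v min_degree_ge_iff[OF G(1)] by blast
    also have "\<dots> \<le> 1 * real (graph_order G)"
      using vertex_degree_le_order[OF G(1)] by simp
    finally show False using G False by simp
  qed
  then show ?thesis by blast
next
  case True
  define \<epsilon> where "\<epsilon> = min 1 (\<eta> / 2)"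
  have \<epsilon>: "0 < \<epsilon>" "\<epsilon> \<le> 1" "2 * \<epsilon> \<le> \<eta>" using assms by (auto simp: \<epsilon>_def)
  \<comment> \<open>The full lists have total size \<open>k * n\<close>, which is at most
    \<open>d\<close> units of \<epsilon> times \<open>n\<close>.\<close>
  define d where "d = nat \<lceil>real k / \<epsilon>\<rceil>"
  have d: "real k \<le> real d * \<epsilon>"
    using real_nat_ceiling_ge[of "real k / \<epsilon>"] \<epsilon>(1) unfolding d_def by (subst (asm) pos_divide_le_eq)
  obtain M \<alpha> where \<alpha>: "0 < \<alpha>" "\<alpha> \<le> 1" and M: "\<forall>(G :: 'v ugraph) L. simple_graph G \<and> verts G \<noteq> {} \<and> (\<forall>v. L v \<subseteq> {..<k}) \<and>
       real (\<Sum>v\<in>verts G. card (L v)) \<le> real d * (\<epsilon> * real (graph_order G)) \<and>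
       \<not> (\<exists>F\<subseteq>edges G. real (card F) \<le> 2 * \<epsilon> * (real (graph_order G))\<^sup>2 \<and> colourable k (delete_edges G F)) \<longrightarrow>
       \<alpha> * real (graph_order G) ^ M
         \<le> real (card {x \<in> {..<M} \<rightarrow>\<^sub>E verts G. \<not> list_colourable (edges G) L (x ` {..<M})})"
    using many_uncolourable_tuples[OF assms(2) \<epsilon>(1,2), of d] by (elim exE conjE)
  have "\<alpha> / 2 > 0" using \<alpha> by simp
  from most_tuples_inherit_min_degree[OF assms(3,4) True this] obtain N0 where N0:
    "\<forall>N\<ge>N0. \<forall>V :: 'v set. \<forall>nb. finite V \<and>
       (\<forall>v\<in>V. c * real (card V) \<le> real (card {u \<in> V. nb v u})) \<longrightarrow>
       real (card {x \<in> {..<N} \<rightarrow>\<^sub>E V. \<exists>i<N. real (card {j \<in> {..<N}. nb (x i) (x j)}) < b * real N})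
             \<le> \<alpha> / 2 * real (card V) ^ N" ..
  \<comment> \<open>\<open>N0\<close> is needed for the degrees and \<open>M\<close> for the
    uncolourable tuples; positivity gives the tuple graph a vertex.\<close>
  define N where "N = max 1 (max N0 M)"
  have N: "N \<ge> N0" "N \<ge> M" "N > 0" by (auto simp: N_def)
  from graph_free_few_homomorphic_tuples[OF H \<open>\<alpha> / 2 > 0\<close>, of N] obtain n1 where n1:
    "\<forall>G :: 'v ugraph. simple_graph G \<and> graph_order G \<ge> n1 \<and> graph_free H G \<longrightarrow>
       real (card {x \<in> {..<N} \<rightarrow>\<^sub>E verts G. homomorphic H (tuple_graph G N x)})
             < \<alpha> / 2 * real (graph_order G) ^ N" ..
  show ?thesis
  proof (intro exI[of _ "max 1 n1"] allI impI, elim conjE, rule ccontr)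
    fix G :: "'v ugraph"
    assume G: "simple_graph G" and n: "max 1 n1 \<le> graph_order G" and free: "graph_free H G"
      and deg: "c * real (graph_order G) \<le> real (min_degree G)"
      and far: "\<not> (\<exists>F\<subseteq>edges G. real (card F) \<le> \<eta> * (real (graph_order G))\<^sup>2 \<and> colourable k (delete_edges G F))"
    define V E n where "V = verts G" and "E = edges G" and "n = real (graph_order G)"
    have V: "finite V" "n = real (card V)" "V \<noteq> {}"
      using G n by (auto simp: simple_graph_def V_def n_def graph_order_def)
    define T where "T = {..<N} \<rightarrow>\<^sub>E V"
    have finT: "finite T" using V by (auto simp: T_def intro: finite_PiE)
    define bad where "bad x \<longleftrightarrow> \<not> list_colourable E (\<lambda>_. {..<k}) (x ` {..<N})" for x
    define low where "low x \<longleftrightarrow> (\<exists>i<N. real (card {j \<in> {..<N}. {x j, x i} \<in> E}) < b * real N)" for x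
    have "2 * \<epsilon> * n\<^sup>2 \<le> \<eta> * n\<^sup>2" using \<epsilon> by (intro mult_right_mono) auto
    then have far': "\<not> (\<exists>F\<subseteq>edges G. real (card F) \<le> 2 * \<epsilon> * (real (graph_order G))\<^sup>2 \<and> colourable k (delete_edges G F))"
      using far order_trans unfolding n_def by blast
    have "real (\<Sum>v\<in>verts G. card {..<k}) \<le> real d * (\<epsilon> * real (graph_order G))"
      using mult_right_mono[OF d, of n] V by (simp add: n_def V_def algebra_simps)
    then have "\<alpha> * n ^ M \<le> real (card {x \<in> {..<M} \<rightarrow>\<^sub>E V. \<not> list_colourable E (\<lambda>_. {..<k}) (x ` {..<M})})"
      using M[rule_format, of G "\<lambda>_. {..<k}"] G far' V(3) unfolding V_def E_def n_def by blast
    \<comment> \<open>Uncolourable tuples of length \<open>M\<close> are padded with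
      \<open>N - M\<close> free entries, which keeps them uncolourable.\<close>
    then have "\<alpha> * n ^ M * n ^ (N - M) \<le>
        real (card {x \<in> {..<M} \<rightarrow>\<^sub>E V. \<not> list_colourable E (\<lambda>_. {..<k}) (x ` {..<M})}) *
        real (card {x \<in> {..<N - M} \<rightarrow>\<^sub>E V. True})"
      using V by (intro mult_mono) (auto simp: card_funcsetE)
    also have "\<dots> \<le> real (card {x \<in> T. bad x})"
      using card_tuples_append[OF V(1) mono_not_list_colourable[of E "\<lambda>_. {..<k}"], of "\<lambda>_. True" M "N - M"] N(2)
      unfolding T_def bad_def of_nat_mult[symmetric] of_nat_le_iff by (simp add: mono_def)
    finally have badc: "\<alpha> * n ^ N \<le> real (card {x \<in> T. bad x})"
      using N(2) by (simp add: mult.assoc flip: power_add)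
    have "\<forall>v\<in>V. c * real (card V) \<le> real (card {u \<in> V. {u, v} \<in> E})"
      using deg min_degree_ge_iff[OF G] V
      by (auto simp: V_def E_def n_def vertex_degree_def)
    then have lowc: "real (card {x \<in> T. low x}) \<le> \<alpha> / 2 * n ^ N"
      using N0[rule_format, OF N(1), of V "\<lambda>v u. {u, v} \<in> E"] V
      unfolding T_def low_def by blast
    have sub: "{x \<in> T. bad x} \<subseteq> {x \<in> T. low x} \<union> {x \<in> T. homomorphic H (tuple_graph G N x)}"
    proof (clarify, rule ccontr)
      fix x assume x: "x \<in> T" "bad x" "\<not> low x" "\<not> homomorphic H (tuple_graph G N x)"
      have "vertex_degree (tuple_graph G N x) i = card {j \<in> {..<N}. {x j, x i} \<in> E}" if "i < N" for i
        unfolding vertex_degree_def using that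
        by (intro arg_cong[of _ _ card]) (auto simp: edges_tuple_graph_iff E_def)
      moreover have "b * real N \<le> real (card {j \<in> {..<N}. {x j, x i} \<in> E})" if "i < N" for i
        using x(3) that unfolding low_def by (meson not_less)
      ultimately have "b * real (graph_order (tuple_graph G N x)) \<le> real (min_degree (tuple_graph G N x))"
        using N(3) by (subst min_degree_ge_iff[OF simple_graph_tuple_graph[OF G]])
          (auto simp: graph_order_def)
      then have "colourable k (tuple_graph G N x)"
        using hom[OF simple_graph_tuple_graph[OF G]] x(4) by blast
      then show False
        using list_colourable_if_colourable_tuple_graph x(2) by (auto simp: bad_def E_def)
    qed
    have "card {x \<in> T. bad x} \<le> card {x \<in> T. low x} + card {x \<in> T. homomorphic H (tuple_graph G N x)}"
      by (rule order_trans[OF card_mono[OF _ sub] card_Un_le]) (use finT in simp)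
    moreover have "real (card {x \<in> T. homomorphic H (tuple_graph G N x)}) < \<alpha> / 2 * n ^ N"
      using n1[rule_format, of G] G n free by (simp add: T_def V_def n_def)
    ultimately have "real (card {x \<in> T. bad x}) < \<alpha> * n ^ N" using lowc by linarith
    with badc show False by linarith
  qed
qed

subsection \<open>Blow-ups\<close>

lemma card_div_vimage:
  fixes S :: "nat set"
  assumes "finite S" "t > 0"
  shows "finite {m. m div t \<in> S}" "card {m. m div t \<in> S} = t * card S"
proof -
  have bij: "bij_betw (\<lambda>(v, i). v * t + i) (S \<times> {..<t}) {m. m div t \<in> S}"
    by (rule bij_betw_byWitness[where f' = "\<lambda>m. (m div t, m mod t)"]) (use assms in auto)
  show "finite {m. m div t \<in> S}" using bij_betw_finite[OF bij] assms by simp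
  show "card {m. m div t \<in> S} = t * card S"
    using bij_betw_same_card[OF bij] by (simp add: card_cartesian_product mult.commute)
qed

text \<open>The fibre over the vertex \<open>v\<close> is \<open>{v * t..<v * t + t}\<close>, which keeps the blow-up a graph on \<open>nat\<close>.\<close>
definition blow_up :: "nat \<Rightarrow> nat ugraph \<Rightarrow> nat ugraph" where
  "blow_up t G = \<lparr>verts = {m. m div t \<in> verts G}, edges = {{a, b} | a b. {a div t, b div t} \<in> edges G}\<rparr>"

lemma edges_blow_up_iff: "{a, b} \<in> edges (blow_up t G) \<longleftrightarrow> {a div t, b div t} \<in> edges G"
  by (auto simp: blow_up_def doubleton_eq_iff insert_commute)

lemma verts_blow_up: "verts (blow_up t G) = {m. m div t \<in> verts G}"
  by (simp add: blow_up_def)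

lemma simple_graph_blow_up:
  assumes "simple_graph G" "t > 0"
  shows "simple_graph (blow_up t G)"
proof -
  have "card {a, b} = 2" if "{a div t, b div t} \<in> edges G" for a b
  proof -
    have "a \<noteq> b" using edge_vertices(3)[OF assms(1) that] by auto
    then show ?thesis by simp
  qed
  moreover have "a div t \<in> verts G" "b div t \<in> verts G" if "{a div t, b div t} \<in> edges G" for a b
    using edge_vertices[OF assms(1) that] by auto
  moreover have "finite {m. m div t \<in> verts G}"
    using assms card_div_vimage(1) by (simp add: simple_graph_def)
  ultimately show ?thesis by (auto simp: simple_graph_def blow_up_def)
qed

lemma graph_order_blow_up:
  assumes "simple_graph G" "t > 0"
  shows "graph_order (blow_up t G) = t * graph_order G"
  using assms card_div_vimage(2)[of "verts G" t] by (simp add: graph_order_def verts_blow_up simple_graph_def)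

lemma vertex_degree_blow_up:
  assumes "simple_graph G" "t > 0"
  shows "vertex_degree (blow_up t G) a = t * vertex_degree G (a div t)"
proof -
  have "{u \<in> verts (blow_up t G). {u, a} \<in> edges (blow_up t G)}
      = {m. m div t \<in> {u \<in> verts G. {u, a div t} \<in> edges G}}"
    by (simp add: edges_blow_up_iff verts_blow_up)
  then show ?thesis
    unfolding vertex_degree_def using assms card_div_vimage(2)[of "{u \<in> verts G. {u, a div t} \<in> edges G}" t]
    by (simp add: simple_graph_def)
qed

text \<open>Projecting a copy of \<open>H\<close> along \<open>div t\<close> gives a homomorphism
  from \<open>H\<close> to \<open>G\<close>.\<close>

lemma graph_free_blow_up:
  assumes "simple_graph H" "\<not> homomorphic H G"
  shows "graph_free H (blow_up t G)"
  unfolding graph_free_def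
proof
  assume "\<exists>K. subgraph K (blow_up t G) \<and> isomorphic H K"
  then obtain K :: "nat ugraph" and f where K: "verts K \<subseteq> verts (blow_up t G)" "edges K \<subseteq> edges (blow_up t G)"
    and f: "bij_betw f (verts H) (verts K)"
      "\<forall>u\<in>verts H. \<forall>v\<in>verts H. {u, v} \<in> edges H \<longleftrightarrow> {f u, f v} \<in> edges K"
    unfolding subgraph_def isomorphic_def by blast
  have "(\<lambda>u. f u div t) ` verts H \<subseteq> verts G"
    using f(1) K(1) by (auto simp: bij_betw_def verts_blow_up)
  moreover have "{f u div t, f v div t} \<in> edges G" if "{u, v} \<in> edges H" for u v
  proof -
    have "{f u, f v} \<in> edges K" using f(2) edge_vertices[OF assms(1) that] that by blast
    then show ?thesis using K(2) edges_blow_up_iff by blast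
  qed
  ultimately have "homomorphic H G" unfolding homomorphic_def by blast
  with assms(2) show False ..
qed

text \<open>The most popular colours of the fibres do not form a proper colouring of
  \<open>G\<close>, so two adjacent fibres share theirs. Each of the two colour classes has at least
  \<open>t / k\<close> elements, and all edges between them must belong to \<open>F\<close>.\<close>

lemma blow_up_far_from_colourable:
  assumes G: "simple_graph G" and t: "t > 0" and k: "k > 0" and "\<not> colourable k G"
    and F: "F \<subseteq> edges (blow_up t G)" "colourable k (delete_edges (blow_up t G) F)"
  shows "t ^ 2 \<le> k ^ 2 * card F"
proof -
  obtain c where "c ` {m. m div t \<in> verts G} \<subseteq> {..<k}"
    "\<forall>a b. {a, b} \<in> edges (blow_up t G) - F \<longrightarrow> c a \<noteq> c b"
    using F(2) unfolding colourable_def delete_edges_def ugraph.simps verts_blow_up by blast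
  then have c: "c a < k" if "a div t \<in> verts G" for a
    using that by auto
  have cF: "c a \<noteq> c b" if "{a, b} \<in> edges (blow_up t G)" "{a, b} \<notin> F" for a b
    using that \<open>\<forall>a b. {a, b} \<in> edges (blow_up t G) - F \<longrightarrow> c a \<noteq> c b\<close> by blast
  define A where "A v = {a. a div t = v}" for v :: nat
  have A: "finite (A v)" "card (A v) = t" for v
    using card_div_vimage[of "{v}" t] t by (auto simp: A_def)
  have "\<exists>j<k. t \<le> card (c -` {j} \<inter> A v) * k" if "v \<in> verts G" for v
  proof -
    have "c \<in> A v \<rightarrow> {..<k}" using c that by (auto simp: A_def)
    from pigeonhole_card[OF this A(1)] show ?thesis using k A by auto
  qed
  then obtain \<phi> where \<phi>: "\<And>v. v \<in> verts G \<Longrightarrow> \<phi> v < k \<and> t \<le> card (c -` {\<phi> v} \<inter> A v) * k" by metis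
  then have "\<phi> ` verts G \<subseteq> {..<k}" by auto
  then obtain u v where uv: "{u, v} \<in> edges G" "\<phi> u = \<phi> v"
    using \<open>\<not> colourable k G\<close> unfolding colourable_def by blast
  note uvG = edge_vertices[OF G uv(1)]
  define C where "C w = c -` {\<phi> u} \<inter> A w" for w
  have "(\<lambda>(a, b). {a, b}) ` (C u \<times> C v) \<subseteq> F"
  proof clarify
    fix a b assume ab: "a \<in> C u" "b \<in> C v"
    then have "{a, b} \<in> edges (blow_up t G)" using uv by (simp add: edges_blow_up_iff C_def A_def)
    moreover have "c a = c b" using ab by (simp add: C_def)
    ultimately show "{a, b} \<in> F" using cF by blast
  qed
  moreover have "inj_on (\<lambda>(a, b). {a, b}) (C u \<times> C v)"
    using uvG(3) by (auto simp: inj_on_def doubleton_eq_iff C_def A_def)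
  moreover have "finite F"
  proof -
    have "edges (blow_up t G) \<subseteq> Pow (verts (blow_up t G))" "finite (verts (blow_up t G))"
      using simple_graph_blow_up[OF G t] by (auto simp: simple_graph_def)
    then show ?thesis using F(1) finite_subset finite_Pow_iff by metis
  qed
  ultimately have "card (C u \<times> C v) \<le> card F" by (intro card_inj_on_le)
  then have "card (C u) * card (C v) \<le> card F" by (simp add: card_cartesian_product)
  then have kF: "k * k * (card (C u) * card (C v)) \<le> k * k * card F" by (rule mult_le_mono2)
  have "t * t \<le> (card (C u) * k) * (card (C v) * k)"
    using \<phi>[OF uvG(1)] \<phi>[OF uvG(2)] uv(2) by (intro mult_le_mono) (auto simp: C_def)
  also have "\<dots> = k * k * (card (C u) * card (C v))" by (simp add: mult.assoc mult.left_commute)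
  also note kF
  finally show ?thesis by (simp add: power2_eq_square)
qed

text \<open>Blowing up multiplies degrees and order by the same \<open>t\<close>, so a
  counterexample \<open>G\<close> yields arbitrarily large \<open>H\<close>-free graphs of the same
  relative degree that stay far from \<open>k\<close>-colourable.\<close>

lemma hom_threshold_of_approx_threshold:
  fixes H :: "'a ugraph" and G :: "nat ugraph" and c :: real
  assumes H: "simple_graph H" and k: "k > 0"
    and approx: "\<And>\<eta>. \<eta> > 0 \<Longrightarrow> \<exists>n0::nat. \<forall>G :: nat ugraph.
          simple_graph G \<and> graph_order G \<ge> n0 \<and> graph_free H G \<and>
          real (min_degree G) \<ge> c * real (graph_order G) \<longrightarrow>
          (\<exists>F\<subseteq>edges G. real (card F) \<le> \<eta> * (real (graph_order G))\<^sup>2 \<and>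
                         colourable k (delete_edges G F))"
    and G: "simple_graph G" "real (min_degree G) \<ge> c * real (graph_order G)" "\<not> homomorphic H G"
  shows "colourable k G"
proof (rule ccontr)
  assume nc: "\<not> colourable k G"
  then have ne: "verts G \<noteq> {}" using colourable_if_no_verts[OF G(1)] by blast
  then have n: "real (graph_order G) > 0"
    using G(1) by (simp add: graph_order_def simple_graph_def card_gt_0_iff)
  \<comment> \<open>Half of the proportion \<open>1 / (k * n)^2\<close>, with \<open>n\<close> the
    order of \<open>G\<close>, that has to be deleted from every blow-up.\<close>
  define \<eta> where "\<eta> = 1 / (2 * (real k * real (graph_order G))\<^sup>2)"
  have "\<eta> > 0" using n k by (simp add: \<eta>_def)
  from approx[OF this] obtain n0 where n0: "\<forall>G :: nat ugraph.
          simple_graph G \<and> graph_order G \<ge> n0 \<and> graph_free H G \<and>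
          real (min_degree G) \<ge> c * real (graph_order G) \<longrightarrow>
          (\<exists>F\<subseteq>edges G. real (card F) \<le> \<eta> * (real (graph_order G))\<^sup>2 \<and>
                         colourable k (delete_edges G F))" ..
  define t where "t = Suc n0"
  have t: "t > 0" by (simp add: t_def)
  define G' where "G' = blow_up t G"
  have G': "simple_graph G'" "graph_order G' = t * graph_order G" "graph_free H G'"
    unfolding G'_def using simple_graph_blow_up[OF G(1) t] graph_order_blow_up[OF G(1) t]
      graph_free_blow_up[OF H G(3)] by auto
  have "verts G' \<noteq> {}"
    using ne t by (auto simp: G'_def verts_blow_up) (metis div_mult_self_is_m)
  then have "c * real (graph_order G') \<le> real (min_degree G')"
    using G(2) min_degree_ge_iff[OF G(1) ne] t
    by (subst min_degree_ge_iff[OF G'(1)])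
      (auto simp: G'(2), auto simp: G'_def vertex_degree_blow_up[OF G(1) t] verts_blow_up)
  moreover have "graph_order G' \<ge> n0"
  proof -
    have "n0 * 1 \<le> t * graph_order G" using n by (intro mult_le_mono) (auto simp: t_def)
    then show ?thesis by (simp add: G'(2))
  qed
  ultimately obtain F where F: "F \<subseteq> edges G'" "real (card F) \<le> \<eta> * (real (graph_order G'))\<^sup>2"
    "colourable k (delete_edges G' F)"
    using n0 G'(1,3) by blast
  have "t ^ 2 \<le> k ^ 2 * card F"
    using blow_up_far_from_colourable[OF G(1) t k nc] F unfolding G'_def by blast
  then have "real (t ^ 2) \<le> real (k ^ 2 * card F)" by (rule of_nat_mono)
  also have "\<dots> = (real k)\<^sup>2 * real (card F)" by simp
  also have "\<dots> \<le> (real k)\<^sup>2 * (\<eta> * (real (graph_order G'))\<^sup>2)"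
    using F(2) by (intro mult_left_mono) auto
  also have "\<dots> = (real t)\<^sup>2 / 2"
    using n k by (simp add: \<eta>_def G'(2) power_mult_distrib field_simps)
  finally show False using t by simp
qed

section \<open>Comparison of the two infima\<close>

theorem theorem1p5:
  fixes H :: "'a ugraph" and k :: nat
  assumes "simple_graph H" and "k > 0"
  shows "approx_chromatic_profile H k = hom_chromatic_profile H k"
proof -
  define A where "A = {c::real. c \<ge> 0 \<and>
       (\<forall>\<eta>>0. \<exists>n0::nat. \<forall>G :: nat ugraph.
          simple_graph G \<and> graph_order G \<ge> n0 \<and> graph_free H G \<and>
          real (min_degree G) \<ge> c * real (graph_order G) \<longrightarrow>
          (\<exists>F\<subseteq>edges G. real (card F) \<le> \<eta> * (real (graph_order G))\<^sup>2 \<and>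
                         colourable k (delete_edges G F)))}"
  define B where "B = {c::real. c \<ge> 0 \<and>
       (\<forall>G :: nat ugraph.
          simple_graph G \<and> real (min_degree G) \<ge> c * real (graph_order G) \<and>
          \<not> homomorphic H G \<longrightarrow> colourable k G)}"
  have AB: "A \<subseteq> B"
  proof
    fix c assume "c \<in> A"
    then show "c \<in> B"
      using hom_threshold_of_approx_threshold[OF assms, of c] unfolding A_def B_def by blast
  qed
  have BA: "c \<in> A" if "b \<in> B" "b < c" for b c
    using approx_threshold_of_hom_threshold[OF assms _ that(2)] that unfolding A_def B_def by auto
  \<comment> \<open>No graph with a vertex has minimum degree twice its order. Hence both sets are
    nonempty, and with the lower bound 0 their infima are meaningful.\<close>
  have "2 \<in> B"
  proof -
    have "colourable k G" if G: "simple_graph G" "2 * real (graph_order G) \<le> real (min_degree G)" for G :: "nat ugraph"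
    proof (cases "verts G = {}")
      case True
      then show ?thesis using colourable_if_no_verts[OF G(1)] by blast
    next
      case False
      then obtain v where v: "v \<in> verts G" by blast
      have fin: "finite (verts G)" using G by (simp add: simple_graph_def)
      have "2 * real (graph_order G) \<le> real (vertex_degree G v)"
        using G(2) v min_degree_ge_iff[OF G(1) False] by blast
      also have "\<dots> \<le> real (graph_order G)"
        using vertex_degree_le_order[OF G(1)] by simp
      finally show ?thesis using False fin by (simp add: graph_order_def)
    qed
    then show ?thesis by (auto simp: B_def)
  qed
  then have "3 \<in> A" by (rule BA) simp
  have bdd: "bdd_below A" "bdd_below B" by (auto simp: A_def B_def intro: bdd_belowI[of _ 0])
  have "Inf B \<le> Inf A"
    using \<open>3 \<in> A\<close> AB bdd by (intro cInf_superset_mono) auto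
  \<comment> \<open>An element \<open>b\<close> of \<open>B\<close> is not shown to lie in
    \<open>A\<close>, but every \<open>c\<close> above it does, which suffices for the
    infimum.\<close>
  moreover have "Inf A \<le> Inf B"
  proof (rule cInf_greatest)
    fix b assume "b \<in> B"
    then have "Inf A \<le> c" if "b < c" for c using cInf_lower[OF BA bdd(1)] that by blast
    then show "Inf A \<le> b" by (rule dense_ge)
  qed (use \<open>2 \<in> B\<close> in auto)
  ultimately show ?thesis
    unfolding approx_chromatic_profile_def hom_chromatic_profile_def A_def B_def by linarith
qed

end
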